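(* Let $k\in\mathbb{Z}^+$ with $k>1$ and $\pi\in S_k$. There exists a constant $C=C(\pi)$ such that for all integers $m,n\ge 0$ with $m\le\binom{n}{k}$, the number of permutations in $S_n$ containing at most $m$ copies of $\pi$ is at most \[\exp(Cn)\max\left(1,\left(\frac{m}{n}\right)^{\frac{n}{k-1}}\right).\] Furthermore, this bound is sharp to within an exponential factor: there is a constant $C'=C'(\pi)$ such that for all such $m,n$ the number of permutations in $S_n$ containing at most $m$ copies of $\pi$ is at least $\exp(C'n)\max\left(1,\left(\frac{m}{n}\right)^{\frac{n}{k-1}}\right)$.
   Context: A copy of $\pi\in S_k$ in $\sigma\in S_n$ is a set of indices $1\le x_1<\dots<x_k\le n$ such that for all $i,j$, $\pi(i)<\pi(j)\iff\sigma(x_i)<\sigma(x_j)$. *)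

theory Defs
  imports "HOL-Analysis.Analysis" "HOL-Library.FuncSet"
begin

text \<open>Permutations of S_n are bijections of {1..n} (identity outside).
  A copy of pi (in S_k) in sigma (in S_n) is a set of indices x_1 < ... < x_k in {1..n};
  we represent it by the strictly increasing map i \<mapsto> x_i on {1..k} (extensional,
  i.e. undefined outside {1..k}), which is in bijection with the index set.\<close>

definition copies :: "nat \<Rightarrow> (nat \<Rightarrow> nat) \<Rightarrow> nat \<Rightarrow> (nat \<Rightarrow> nat) \<Rightarrow> (nat \<Rightarrow> nat) set" where
  "copies k \<pi> n \<sigma> =
     {x \<in> {1..k} \<rightarrow>\<^sub>E {1..n}. strict_mono_on {1..k} x \<and>
        (\<forall>i\<in>{1..k}. \<forall>j\<in>{1..k}. \<pi> i < \<pi> j \<longleftrightarrow> \<sigma> (x i) < \<sigma> (x j))}"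

definition num_copies :: "nat \<Rightarrow> (nat \<Rightarrow> nat) \<Rightarrow> nat \<Rightarrow> (nat \<Rightarrow> nat) \<Rightarrow> nat" where
  "num_copies k \<pi> n \<sigma> = card (copies k \<pi> n \<sigma>)"

definition num_perms_at_most :: "nat \<Rightarrow> (nat \<Rightarrow> nat) \<Rightarrow> nat \<Rightarrow> nat \<Rightarrow> nat" where
  "num_perms_at_most k \<pi> n m = card {\<sigma>. \<sigma> permutes {1..n} \<and> num_copies k \<pi> n \<sigma> \<le> m}"

end

theory Submission
  imports Defs
begin

text \<open>Lower bound: replacing \<open>\<pi>\<close> by its complement we may assume \<open>\<pi> k < \<pi> 1\<close>, so in a direct sum
  of blocks every copy of \<open>\<pi>\<close> lies inside one block. Arbitrary permutations in blocks of size
  \<open>s = (m/n)^(1/(k-1))\<close> have at most \<open>n s^(k-1) \<le> m\<close> copies, and there are about \<open>s^n\<close> of them.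

  Upper bound: cut the graph of a permutation with at most \<open>m \<ge> n\<close> copies into square cells of side
  a constant multiple of \<open>2^i s\<close>, for all \<open>i\<close>. By the Marcus--Tardos theorem applied to a random subset
  of the points, which has fewer copies of \<open>\<pi>\<close> than cells, at each scale \<open>q\<close> only \<open>O(n/q)\<close> cells are
  heavily populated and few points lie outside of these. The at most \<open>n/2\<close> points that are light at some
  scale form a smaller permutation with at most \<open>m\<close> copies and are counted by induction. For the other
  points the heavy cells at the finest scale can be chosen in \<open>exp(O(n))\<close> ways, by refining them scale
  by scale from the coarsest one, and given these cells each point has \<open>O(s)\<close> positions in the geometric
  mean.\<close>

section \<open>Copies of a pattern in a set of points\<close>

text \<open>A free choice of \<open>O(n/s)\<close> heavy cells at scale \<open>s\<close> would cost
  \<open>exp(O((n/s) log(n/s)))\<close>, and for bounded \<open>s\<close> the logarithm is fatal.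
  Refining through doubling scales costs only \<open>exp(O(n/q))\<close> at scale \<open>q\<close>,
  which sums geometrically; this is why sparsity is needed at all scales at once. The sampling
  probability is multiplied by a fixed \<open>r\<close> at each doubling. The expected number of
  surviving copies must stay below \<open>n/q\<close>, which needs \<open>2 r^k \<le> 1\<close> for
  every \<open>k \<ge> 2\<close>. The number of light points must decay geometrically, which needs
  \<open>2 r > 1\<close>. Any \<open>r\<close> above \<open>1/2\<close> and at most
  \<open>1/sqrt 2\<close> would do; the proof takes \<open>5/8\<close>. The light points are counted
  with the same \<open>m\<close>. With only \<open>n' \<le> n/2\<close> points the ratio
  \<open>m/n'\<close> exceeds \<open>m/n\<close>, but the loss is at most
  \<open>(n/n')^(n'/(k-1)) \<le> exp(n)\<close>. The halving also keeps the constant in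
  \<open>exp(O(n))\<close> from growing along the induction.\<close>

definition cop :: "nat \<Rightarrow> (nat \<Rightarrow> nat) \<Rightarrow> (nat \<times> nat) set \<Rightarrow> (nat \<Rightarrow> nat \<times> nat) set" where
  "cop k \<pi> A = {g \<in> {1..k} \<rightarrow>\<^sub>E A. \<forall>i\<in>{1..k}. \<forall>j\<in>{1..k}.
     (fst (g i) < fst (g j) \<longleftrightarrow> i < j) \<and> (snd (g i) < snd (g j) \<longleftrightarrow> \<pi> i < \<pi> j)}"

lemma finite_cop: "finite A \<Longrightarrow> finite (cop k \<pi> A)"
  unfolding cop_def by (rule finite_subset[of _ "{1..k} \<rightarrow>\<^sub>E A"]) (auto intro: finite_PiE)

lemma cop_mono: "A \<subseteq> B \<Longrightarrow> cop k \<pi> A \<subseteq> cop k \<pi> B"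
  unfolding cop_def by (auto simp: PiE_def Pi_def)

text \<open>Both orders are total and \<open>\<pi>\<close> is injective on \<open>{1..k}\<close>, so
  the forward implications already yield the equivalences in \<open>cop\<close>.\<close>

lemma copI:
  assumes "inj_on \<pi> {1..k}" "\<And>i. i \<in> {1..k} \<Longrightarrow> g i \<in> A"
    and "\<And>i j. i \<in> {1..k} \<Longrightarrow> j \<in> {1..k} \<Longrightarrow> i < j \<Longrightarrow> fst (g i) < fst (g j)"
    and "\<And>i j. i \<in> {1..k} \<Longrightarrow> j \<in> {1..k} \<Longrightarrow> \<pi> i < \<pi> j \<Longrightarrow> snd (g i) < snd (g j)"
  shows "restrict g {1..k} \<in> cop k \<pi> A"
proof -
  have "(fst (g i) < fst (g j) \<longleftrightarrow> i < j) \<and> (snd (g i) < snd (g j) \<longleftrightarrow> \<pi> i < \<pi> j)"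
    if ij: "i \<in> {1..k}" "j \<in> {1..k}" for i j
  proof (cases "i = j")
    case False
    then have "\<pi> i \<noteq> \<pi> j" using assms(1) ij by (auto dest: inj_onD)
    then show ?thesis
      using False assms(3,4)[OF ij] assms(3,4)[OF ij(2,1)] by linarith
  qed simp
  then show ?thesis using assms(2) unfolding cop_def by auto
qed

lemma copD:
  assumes "g \<in> cop k \<pi> A"
  shows "i \<in> {1..k} \<Longrightarrow> g i \<in> A"
    and "i \<in> {1..k} \<Longrightarrow> j \<in> {1..k} \<Longrightarrow> fst (g i) < fst (g j) \<longleftrightarrow> i < j"
    and "i \<in> {1..k} \<Longrightarrow> j \<in> {1..k} \<Longrightarrow> snd (g i) < snd (g j) \<longleftrightarrow> \<pi> i < \<pi> j"
    and "g \<in> {1..k} \<rightarrow>\<^sub>E A"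
  using assms unfolding cop_def by (blast dest: PiE_mem)+

lemma cop_inj_on:
  assumes "g \<in> cop k \<pi> A" shows "inj_on g {1..k}"
proof (rule inj_onI)
  fix i j assume ij: "i \<in> {1..k}" "j \<in> {1..k}" and eq: "g i = g j"
  have *: "fst (g i) < fst (g j) \<longleftrightarrow> i < j" "fst (g j) < fst (g i) \<longleftrightarrow> j < i"
    using assms ij unfolding cop_def by blast+
  then show "i = j" unfolding eq by simp
qed

text \<open>Choose a preimage \<open>e b\<close> of each image point \<open>b\<close>. Monotone maps
  reflect strict inequalities, so a copy in the image lifts to a copy in \<open>A\<close>. Distinct
  copies have distinct lifts because \<open>map_prod u v\<close> undoes \<open>e\<close>.\<close>

lemma card_cop_image:
  assumes "inj_on \<pi> {1..k}" "finite A" "mono u" "mono v"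
  shows "card (cop k \<pi> (map_prod u v ` A)) \<le> card (cop k \<pi> A)"
proof -
  let ?f = "map_prod u v"
  define e where "e = inv_into A ?f"
  have e: "e b \<in> A" "?f (e b) = b" if "b \<in> ?f ` A" for b
    using that unfolding e_def by (rule inv_into_into, rule f_inv_into_f)
  have e': "u (fst (e b)) = fst b" "v (snd (e b)) = snd b" if "b \<in> ?f ` A" for b
    using arg_cong[OF e(2)[OF that], of fst] arg_cong[OF e(2)[OF that], of snd] by simp_all
  show ?thesis
  proof (rule card_inj_on_le)
    show "(\<lambda>g. restrict (e \<circ> g) {1..k}) ` cop k \<pi> (?f ` A) \<subseteq> cop k \<pi> A"
    proof safe
      fix g assume g: "g \<in> cop k \<pi> (?f ` A)"
      have gA: "g i \<in> ?f ` A" if "i \<in> {1..k}" for i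
        by (rule copD(1)[OF g that])
      show "restrict (e \<circ> g) {1..k} \<in> cop k \<pi> A"
      proof (rule copI[OF assms(1)])
        fix i j assume ij: "i \<in> {1..k}" "j \<in> {1..k}"
        show "(e \<circ> g) i \<in> A" using e gA ij by simp
        show "fst ((e \<circ> g) i) < fst ((e \<circ> g) j)" if "i < j"
        proof -
          have "u (fst (e (g i))) < u (fst (e (g j)))"
            using copD(2,3)[OF g ij] that e'[OF gA] ij by metis
          then show ?thesis using monoD[OF \<open>mono u\<close>] by (metis comp_apply leD leI)
        qed
        show "snd ((e \<circ> g) i) < snd ((e \<circ> g) j)" if "\<pi> i < \<pi> j"
        proof -
          have "v (snd (e (g i))) < v (snd (e (g j)))"
            using copD(2,3)[OF g ij] that e'[OF gA] ij by metis
          then show ?thesis using monoD[OF \<open>mono v\<close>] by (metis comp_apply leD leI)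
        qed
      qed
    qed
    show "inj_on (\<lambda>g. restrict (e \<circ> g) {1..k}) (cop k \<pi> (?f ` A))"
    proof (rule inj_onI)
      fix g h assume g: "g \<in> cop k \<pi> (?f ` A)" and h: "h \<in> cop k \<pi> (?f ` A)"
        and eq: "restrict (e \<circ> g) {1..k} = restrict (e \<circ> h) {1..k}"
      show "g = h"
      proof (rule PiE_ext)
        show "g \<in> {1..k} \<rightarrow>\<^sub>E ?f ` A" "h \<in> {1..k} \<rightarrow>\<^sub>E ?f ` A"
          by (rule copD(4)[OF g], rule copD(4)[OF h])
        fix i assume i: "i \<in> {1..k}"
        then have "e (g i) = e (h i)" using eq by (metis comp_apply restrict_apply')
        moreover have "g i \<in> ?f ` A" "h i \<in> ?f ` A" by (rule copD(1)[OF g i], rule copD(1)[OF h i])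
        ultimately show "g i = h i" using e(2) by metis
      qed
    qed
    show "finite (cop k \<pi> A)" using assms finite_cop by blast
  qed
qed

section \<open>Grid cells and contraction of a point set\<close>

definition cell :: "nat \<Rightarrow> nat \<times> nat \<Rightarrow> nat \<times> nat" where
  "cell q = map_prod (\<lambda>x. x div q) (\<lambda>y. y div q)"

lemma cell_Pair [simp]: "cell q (x, y) = (x div q, y div q)"
  by (simp add: cell_def)

lemma cell_eq: "cell q p = (fst p div q, snd p div q)"
  by (simp add: cell_def map_prod_def case_prod_beta)

text \<open>Even if \<open>A\<close> is the graph of a permutation, its contraction can have several
  points in a row or column; this is why \<open>cop\<close> is set up for arbitrary point
  sets.\<close>

definition contr :: "nat \<Rightarrow> (nat \<times> nat) set \<Rightarrow> (nat \<times> nat) set" where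
  "contr q A = cell q ` A"

lemma mono_div: "mono (\<lambda>x::nat. x div q)"
  by (auto intro: monoI div_le_mono)

lemma card_cop_contr:
  "inj_on \<pi> {1..k} \<Longrightarrow> finite A \<Longrightarrow> card (cop k \<pi> (contr q A)) \<le> card (cop k \<pi> A)"
  unfolding contr_def cell_def by (intro card_cop_image mono_div)

lemma finite_contr: "finite A \<Longrightarrow> finite (contr q A)"
  by (simp add: contr_def)

section \<open>Strips of cells in which every pattern is forced\<close>

lemma pigeonhole_common_subset:
  assumes "finite W" "finite V" and T: "\<And>w. w \<in> W \<Longrightarrow> T w \<subseteq> V \<and> k \<le> card (T w)"
    and W: "k * (card V choose k) < card W"
  obtains T0 W0 where "T0 \<subseteq> V" "card T0 = k" "W0 \<subseteq> W" "card W0 = k" "\<And>w. w \<in> W0 \<Longrightarrow> T0 \<subseteq> T w"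
proof -
  \<comment> \<open>Fix one \<open>k\<close>-subset of each \<open>T w\<close>. Only
    \<open>card V choose k\<close> subsets are available, so one of them is fixed for more than
    \<open>k\<close> elements of \<open>W\<close>.\<close>
  have "\<exists>S. S \<subseteq> T w \<and> card S = k" if "w \<in> W" for w
    using T[OF that] by (metis obtain_subset_with_card_n)
  then obtain \<tau> where \<tau>: "\<And>w. w \<in> W \<Longrightarrow> \<tau> w \<subseteq> T w \<and> card (\<tau> w) = k" by metis
  let ?P = "{S. S \<subseteq> V \<and> card S = k}"
  have finP: "finite ?P" using \<open>finite V\<close> by simp
  have "\<exists>S\<in>?P. k < card {w \<in> W. \<tau> w = S}"
  proof (rule ccontr)
    assume "\<not> ?thesis"
    then have le: "\<And>S. S \<in> ?P \<Longrightarrow> card {w \<in> W. \<tau> w = S} \<le> k" by (meson not_le)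
    have "W = (\<Union>S\<in>?P. {w \<in> W. \<tau> w = S})"
    proof (rule equalityI; rule subsetI)
      fix w assume "w \<in> W"
      then have "\<tau> w \<in> ?P" using T[of w] \<tau>[of w] by (simp only: mem_Collect_eq subset_trans) auto
      then show "w \<in> (\<Union>S\<in>?P. {w \<in> W. \<tau> w = S})" using \<open>w \<in> W\<close> by simp
    qed simp
    then have "card W = card (\<Union>S\<in>?P. {w \<in> W. \<tau> w = S})" by simp
    also have "\<dots> \<le> (\<Sum>S\<in>?P. card {w \<in> W. \<tau> w = S})" by (rule card_UN_le[OF finP])
    also have "\<dots> \<le> of_nat (card ?P) * k" by (rule sum_bounded_above[OF le])
    also have "\<dots> = k * (card V choose k)" using n_subsets[OF \<open>finite V\<close>] by simp
    finally show False using W by simp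
  qed
  then obtain S where S: "S \<subseteq> V" "card S = k" "k < card {w \<in> W. \<tau> w = S}" by auto
  then obtain W0 where W0: "W0 \<subseteq> {w \<in> W. \<tau> w = S}" "card W0 = k"
    using obtain_subset_with_card_n[of k] by (metis less_imp_le_nat)
  show ?thesis
    by (rule that[of S W0]) (use S W0 \<tau> in auto)
qed

lemma strict_mono_enum:
  assumes "finite (S::nat set)" "card S = k"
  obtains h where "\<And>i. i \<in> {1..k} \<Longrightarrow> h i \<in> S"
    "\<And>i j. i \<in> {1..k} \<Longrightarrow> j \<in> {1..k} \<Longrightarrow> i < j \<Longrightarrow> h i < h j"
proof -
  obtain f where f: "bij_betw f {..<card S} S" "strict_mono_on {..<card S} f"
    using ex_bij_betw_strict_mono_card[OF assms(1)] .
  show ?thesis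
  proof (rule that[of "\<lambda>i. f (i - 1)"])
    fix i j assume ij: "i \<in> {1..k}" "j \<in> {1..k}"
    show "f (i - 1) \<in> S" using f(1) ij assms by (auto simp: bij_betw_def)
    show "f (i - 1) < f (j - 1)" if "i < j"
      by (rule strict_mono_onD[OF f(2)]) (use that ij assms in auto)
  qed
qed

lemma card_div_fibre: "q > 0 \<Longrightarrow> {x. x div q = J} = {J * q..<J * q + (q::nat)}"
  by (auto simp: algebra_simps dividend_less_times_div intro: div_nat_eqI)

text \<open>The wide blocks of the Marcus--Tardos argument, with points in at least \<open>k\<close>
  columns, listed for one vertical strip \<open>J\<close>; \<open>tall_cols\<close> is the
  transposed notion.\<close>

definition wide_rows :: "nat \<Rightarrow> nat \<Rightarrow> (nat \<times> nat) set \<Rightarrow> nat \<Rightarrow> nat set" where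
  "wide_rows k q A J = {r. k \<le> card {x. x div q = J \<and> (\<exists>y. (x, y) \<in> A \<and> y div q = r)}}"

definition tall_cols :: "nat \<Rightarrow> nat \<Rightarrow> (nat \<times> nat) set \<Rightarrow> nat \<Rightarrow> nat set" where
  "tall_cols k q A r = {J. k \<le> card {y. y div q = r \<and> (\<exists>x. (x, y) \<in> A \<and> x div q = J)}}"

lemma div_less_imp_less: "x div q < y div q \<Longrightarrow> x < (y::nat)"
  by (meson div_le_mono leD leI)

text \<open>Otherwise \<open>k\<close> wide blocks of the strip share \<open>k\<close> columns. Each
  of these columns then has a point in each of these blocks, and such a configuration contains every
  pattern of length \<open>k\<close>.\<close>

lemma card_wide_rows:
  assumes \<pi>: "\<pi> permutes {1..k}" and "k > 0" "q > 0" "finite A" and av: "cop k \<pi> A = {}"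
  shows "finite (wide_rows k q A J)" "card (wide_rows k q A J) \<le> k * (q choose k)"
proof -
  let ?T = "\<lambda>r. {x. x div q = J \<and> (\<exists>y. (x, y) \<in> A \<and> y div q = r)}"
  let ?V = "{x. x div q = J}"
  have V: "finite ?V" "card ?V = q" using card_div_fibre[OF \<open>q > 0\<close>] by auto
  have "wide_rows k q A J \<subseteq> (\<lambda>p. snd p div q) ` A"
  proof
    fix r assume "r \<in> wide_rows k q A J"
    then have "card (?T r) > 0" using \<open>k > 0\<close> by (simp add: wide_rows_def)
    then have "?T r \<noteq> {}" by (intro notI) (simp only: card.empty)
    then obtain x where "x \<in> ?T r" by blast
    then show "r \<in> (\<lambda>p. snd p div q) ` A" by force
  qed
  then show fin: "finite (wide_rows k q A J)" using \<open>finite A\<close> finite_surj by blast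
  show "card (wide_rows k q A J) \<le> k * (q choose k)"
  proof (rule ccontr)
    assume "\<not> ?thesis"
    then have gt: "k * (card ?V choose k) < card (wide_rows k q A J)" using V by simp
    obtain T0 W0 where T0: "T0 \<subseteq> ?V" "card T0 = k" and W0: "W0 \<subseteq> wide_rows k q A J" "card W0 = k"
      and sub: "\<And>w. w \<in> W0 \<Longrightarrow> T0 \<subseteq> ?T w"
      by (rule pigeonhole_common_subset[OF fin V(1) _ gt, of ?T]) (auto simp: wide_rows_def)
    obtain c where c: "\<And>i. i \<in> {1..k} \<Longrightarrow> c i \<in> T0"
      "\<And>i j. i \<in> {1..k} \<Longrightarrow> j \<in> {1..k} \<Longrightarrow> i < j \<Longrightarrow> c i < c j"
      using strict_mono_enum[OF finite_subset[OF T0(1) V(1)] T0(2)] by blast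
    obtain r where r: "\<And>i. i \<in> {1..k} \<Longrightarrow> r i \<in> W0"
      "\<And>i j. i \<in> {1..k} \<Longrightarrow> j \<in> {1..k} \<Longrightarrow> i < j \<Longrightarrow> r i < r j"
      using strict_mono_enum[OF finite_subset[OF W0(1) fin] W0(2)] by blast
    have pi: "\<pi> i \<in> {1..k}" if "i \<in> {1..k}" for i using \<pi> that by (metis permutes_in_image)
    \<comment> \<open>The \<open>i\<close>-th column takes its point from the block of rank
      \<open>\<pi> i\<close>, so the order of the blocks dictates the order of the second
      coordinates.\<close>
    have "\<exists>y. (c i, y) \<in> A \<and> y div q = r (\<pi> i)" if "i \<in> {1..k}" for i
      using sub[OF r(1)[OF pi[OF that]]] c(1)[OF that] by blast
    then obtain y where y: "\<And>i. i \<in> {1..k} \<Longrightarrow> (c i, y i) \<in> A \<and> y i div q = r (\<pi> i)" by metis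
    have "restrict (\<lambda>i. (c i, y i)) {1..k} \<in> cop k \<pi> A"
    proof (rule copI)
      show "inj_on \<pi> {1..k}" using permutes_inj_on[OF \<pi>] .
      fix i j assume ij: "i \<in> {1..k}" "j \<in> {1..k}"
      show "snd (c i, y i) < snd (c j, y j)" if "\<pi> i < \<pi> j"
        using r(2)[OF pi[OF ij(1)] pi[OF ij(2)] that] y[OF ij(1)] y[OF ij(2)]
        by (auto intro: div_less_imp_less[of _ q])
    qed (use y c in auto)
    then show False using av by auto
  qed
qed

lemma card_tall_cols:
  assumes \<pi>: "\<pi> permutes {1..k}" and "k > 0" "q > 0" "finite A" and av: "cop k \<pi> A = {}"
  shows "finite (tall_cols k q A r)" "card (tall_cols k q A r) \<le> k * (q choose k)"
proof -
  let ?T = "\<lambda>J. {y. y div q = r \<and> (\<exists>x. (x, y) \<in> A \<and> x div q = J)}"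
  let ?V = "{y. y div q = r}"
  have V: "finite ?V" "card ?V = q" using card_div_fibre[OF \<open>q > 0\<close>] by auto
  have "tall_cols k q A r \<subseteq> (\<lambda>p. fst p div q) ` A"
  proof
    fix J assume "J \<in> tall_cols k q A r"
    then have "card (?T J) > 0" using \<open>k > 0\<close> by (simp add: tall_cols_def)
    then have "?T J \<noteq> {}" by (intro notI) (simp only: card.empty)
    then obtain x where "x \<in> ?T J" by blast
    then show "J \<in> (\<lambda>p. fst p div q) ` A" by force
  qed
  then show fin: "finite (tall_cols k q A r)" using \<open>finite A\<close> finite_surj by blast
  show "card (tall_cols k q A r) \<le> k * (q choose k)"
  proof (rule ccontr)
    assume "\<not> ?thesis"
    then have gt: "k * (card ?V choose k) < card (tall_cols k q A r)" using V by simp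
    obtain T0 W0 where T0: "T0 \<subseteq> ?V" "card T0 = k" and W0: "W0 \<subseteq> tall_cols k q A r" "card W0 = k"
      and sub: "\<And>w. w \<in> W0 \<Longrightarrow> T0 \<subseteq> ?T w"
      by (rule pigeonhole_common_subset[OF fin V(1) _ gt, of ?T]) (auto simp: tall_cols_def)
    obtain c where c: "\<And>i. i \<in> {1..k} \<Longrightarrow> c i \<in> W0"
      "\<And>i j. i \<in> {1..k} \<Longrightarrow> j \<in> {1..k} \<Longrightarrow> i < j \<Longrightarrow> c i < c j"
      using strict_mono_enum[OF finite_subset[OF W0(1) fin] W0(2)] by blast
    obtain y where y: "\<And>i. i \<in> {1..k} \<Longrightarrow> y i \<in> T0"
      "\<And>i j. i \<in> {1..k} \<Longrightarrow> j \<in> {1..k} \<Longrightarrow> i < j \<Longrightarrow> y i < y j"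
      using strict_mono_enum[OF finite_subset[OF T0(1) V(1)] T0(2)] by blast
    have pi: "\<pi> i \<in> {1..k}" if "i \<in> {1..k}" for i using \<pi> that by (metis permutes_in_image)
    \<comment> \<open>Transposed choice: now the rows are exact and the columns are known only up to
      blocks. Point \<open>i\<close> lies in the \<open>i\<close>-th block, on the common row of
      rank \<open>\<pi> i\<close>.\<close>
    have "\<exists>x. (x, y (\<pi> i)) \<in> A \<and> x div q = c i" if "i \<in> {1..k}" for i
      using sub[OF c(1)[OF that]] y(1)[OF pi[OF that]] by blast
    then obtain x where x: "\<And>i. i \<in> {1..k} \<Longrightarrow> (x i, y (\<pi> i)) \<in> A \<and> x i div q = c i" by metis
    have "restrict (\<lambda>i. (x i, y (\<pi> i))) {1..k} \<in> cop k \<pi> A"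
    proof (rule copI)
      show "inj_on \<pi> {1..k}" using permutes_inj_on[OF \<pi>] .
      fix i j assume ij: "i \<in> {1..k}" "j \<in> {1..k}"
      show "fst (x i, y (\<pi> i)) < fst (x j, y (\<pi> j))" if "i < j"
        using c(2)[OF ij that] x[OF ij(1)] x[OF ij(2)] by (auto intro: div_less_imp_less[of _ q])
    qed (use x y pi in auto)
    then show False using av by auto
  qed
qed

section \<open>The Marcus--Tardos theorem\<close>

definition block :: "nat \<Rightarrow> (nat \<times> nat) set \<Rightarrow> nat \<times> nat \<Rightarrow> (nat \<times> nat) set" where
  "block q A b = {p \<in> A. cell q p = b}"

lemma block_subset: "block q A b \<subseteq> A"
  by (auto simp: block_def)

lemma contr_iff_block: "b \<in> contr q A \<longleftrightarrow> block q A b \<noteq> {}"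
  unfolding block_def contr_def by blast

lemma card_blocks: "finite A \<Longrightarrow> (\<Sum>b\<in>contr q A. card (block q A b)) = card A"
proof -
  assume fin: "finite A"
  have "card A = (\<Sum>b\<in>contr q A. \<Sum>a\<in>block q A b. 1)"
    unfolding block_def by (subst sum.group[of _ _ "cell q"]) (use fin in \<open>auto simp: contr_def\<close>)
  then show ?thesis by simp
qed

lemma contr_subset:
  assumes "A \<subseteq> {..<q * t} \<times> {..<q * t}" "q > 0"
  shows "contr q A \<subseteq> {..<t} \<times> {..<t}"
  using assms by (auto simp: contr_def less_mult_imp_div_less mult.commute)

lemma card_block_le:
  assumes "q > 0" "finite A" shows "card (block q A b) \<le> q\<^sup>2"
proof -
  have "block q A b \<subseteq> {x. x div q = fst b} \<times> {y. y div q = snd b}"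
    by (auto simp: block_def)
  then have "card (block q A b) \<le> card ({x. x div q = fst b} \<times> {y. y div q = snd b})"
    by (rule card_mono[rotated]) (simp add: card_div_fibre[OF \<open>q > 0\<close>])
  also have "\<dots> = q\<^sup>2" by (simp add: card_div_fibre[OF \<open>q > 0\<close>] card_cartesian_product power2_eq_square)
  finally show ?thesis .
qed

lemma card_block_narrow:
  assumes "finite A" "q > 0" "snd b \<notin> wide_rows k q A (fst b)" "fst b \<notin> tall_cols k q A (snd b)"
  shows "card (block q A b) \<le> (k - 1)\<^sup>2"
proof -
  let ?X = "{x. x div q = fst b \<and> (\<exists>y. (x, y) \<in> A \<and> y div q = snd b)}"
  let ?Y = "{y. y div q = snd b \<and> (\<exists>x. (x, y) \<in> A \<and> x div q = fst b)}"
  have fin: "finite ?X" "finite ?Y"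
    by (rule finite_subset[of _ "fst ` A"], force, simp add: assms)
       (rule finite_subset[of _ "snd ` A"], force, simp add: assms)
  have "card ?X \<le> k - 1" "card ?Y \<le> k - 1"
    using assms(3,4) by (auto simp: wide_rows_def tall_cols_def)
  then have "card (?X \<times> ?Y) \<le> (k - 1)\<^sup>2"
    unfolding card_cartesian_product power2_eq_square by (rule mult_le_mono)
  moreover have "block q A b \<subseteq> ?X \<times> ?Y" by (auto simp: block_def)
  ultimately show ?thesis
    using card_mono[OF finite_cartesian_product[OF fin]] by (meson le_trans)
qed

text \<open>A block neither wide nor tall meets at most \<open>k - 1\<close> columns and
  \<open>k - 1\<close> rows. The other blocks may be full, with \<open>q^2\<close> points, but each
  of the \<open>t\<close> strips in either direction has at most \<open>k * (q choose k)\<close> of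
  them.\<close>

lemma marcus_tardos_step:
  assumes \<pi>: "\<pi> permutes {1..k}" and "k > 0" "q > 0" and A: "A \<subseteq> {..<q * t} \<times> {..<q * t}"
    and av: "cop k \<pi> A = {}"
  shows "card A \<le> (k - 1)\<^sup>2 * card (contr q A) + 2 * q\<^sup>2 * k * (q choose k) * t"
proof -
  have fin: "finite A" using A by (rule finite_subset) simp
  have finc: "finite (contr q A)" using fin by (rule finite_contr)
  let ?W = "{b \<in> contr q A. snd b \<in> wide_rows k q A (fst b)}"
  let ?T = "{b \<in> contr q A. fst b \<in> tall_cols k q A (snd b)}"
  note wd = card_wide_rows[OF \<pi> \<open>k > 0\<close> \<open>q > 0\<close> fin av]
  note tl = card_tall_cols[OF \<pi> \<open>k > 0\<close> \<open>q > 0\<close> fin av]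
  note sub = contr_subset[OF A \<open>q > 0\<close>]
  have "card ?W \<le> card (Sigma {..<t} (wide_rows k q A))"
    by (rule card_mono) (use sub wd in auto)
  also have "\<dots> = (\<Sum>J<t. card (wide_rows k q A J))" using wd by simp
  also have "\<dots> \<le> of_nat (card {..<t}) * (k * (q choose k))" by (rule sum_bounded_above) (rule wd)
  finally have W: "card ?W \<le> k * (q choose k) * t" by (simp add: mult.commute)
  have "card ?T \<le> card (prod.swap ` Sigma {..<t} (tall_cols k q A))"
    by (rule card_mono) (use sub tl in \<open>auto intro!: image_eqI[of _ prod.swap "(_, _)"]\<close>)
  also have "\<dots> \<le> card (Sigma {..<t} (tall_cols k q A))" using tl by (intro card_image_le) auto
  also have "\<dots> = (\<Sum>J<t. card (tall_cols k q A J))" using tl by simp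
  also have "\<dots> \<le> of_nat (card {..<t}) * (k * (q choose k))" by (rule sum_bounded_above) (rule tl)
  finally have T: "card ?T \<le> k * (q choose k) * t" by (simp add: mult.commute)
  have "card A = (\<Sum>b\<in>contr q A. card (block q A b))" using card_blocks[OF fin] by simp
  also have "\<dots> \<le> (\<Sum>b\<in>contr q A. (k - 1)\<^sup>2 + ((if b \<in> ?W then q\<^sup>2 else 0) + (if b \<in> ?T then q\<^sup>2 else 0)))"
  proof (rule sum_mono)
    fix b assume b: "b \<in> contr q A"
    show "card (block q A b) \<le> (k - 1)\<^sup>2 + ((if b \<in> ?W then q\<^sup>2 else 0) + (if b \<in> ?T then q\<^sup>2 else 0))"
      using card_block_le[OF \<open>q > 0\<close> fin, of b] card_block_narrow[OF fin \<open>q > 0\<close>, of b k] b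
      by (cases "b \<in> ?W"; cases "b \<in> ?T") simp_all
  qed
  also have "\<dots> = (k - 1)\<^sup>2 * card (contr q A) + (q\<^sup>2 * card ?W + q\<^sup>2 * card ?T)"
    using finc by (simp add: sum.distrib sum.inter_filter[symmetric] mult.commute)
  also have "\<dots> \<le> (k - 1)\<^sup>2 * card (contr q A) + (q\<^sup>2 * (k * (q choose k) * t) + q\<^sup>2 * (k * (q choose k) * t))"
    using W T by (intro add_mono mult_left_mono) auto
  finally show ?thesis by (simp add: algebra_simps)
qed

text \<open>Contraction preserves avoidance, so the step can be iterated with
  \<open>q = k^2\<close>. The constant is the coefficient of \<open>t\<close> in the step, and it
  reproduces itself because \<open>(k - 1)^2 + 1 \<le> k^2\<close>.\<close>

lemma marcus_tardos_power:
  assumes \<pi>: "\<pi> permutes {1..k}" and "k > 0" and A: "A \<subseteq> {..<(k\<^sup>2) ^ j} \<times> {..<(k\<^sup>2) ^ j}"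
    and av: "cop k \<pi> A = {}"
  shows "card A \<le> 2 * (k\<^sup>2)\<^sup>2 * k * (k\<^sup>2 choose k) * (k\<^sup>2) ^ j"
  using A av
proof (induction j arbitrary: A)
  case 0
  have "k \<le> k\<^sup>2" using \<open>k > 0\<close> by (simp add: power2_eq_square)
  then have "k\<^sup>2 choose k > 0" by (simp add: zero_less_binomial)
  moreover have "card A \<le> 1" using card_mono[OF _ 0(1)] by simp
  moreover have "2 * (k\<^sup>2)\<^sup>2 * k > 0" using \<open>k > 0\<close> by simp
  ultimately show ?case by (metis One_nat_def Suc_leI le_trans mult.right_neutral nat_0_less_mult_iff power_0)
next
  case (Suc j)
  let ?D = "2 * (k\<^sup>2)\<^sup>2 * k * (k\<^sup>2 choose k)" and ?t = "(k\<^sup>2) ^ j"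
  have q: "k\<^sup>2 > 0" using \<open>k > 0\<close> by simp
  have A: "A \<subseteq> {..<k\<^sup>2 * ?t} \<times> {..<k\<^sup>2 * ?t}" using Suc.prems(1) by simp
  have fin: "finite A" using A by (rule finite_subset) simp
  have "card (cop k \<pi> (contr (k\<^sup>2) A)) \<le> card (cop k \<pi> A)"
    by (rule card_cop_contr[OF permutes_inj_on[OF \<pi>] fin])
  then have "cop k \<pi> (contr (k\<^sup>2) A) = {}" using Suc.prems(2) finite_cop finite_contr[OF fin] by auto
  then have "card (contr (k\<^sup>2) A) \<le> ?D * ?t" by (rule Suc.IH[OF contr_subset[OF A q]])
  then have "card A \<le> (k - 1)\<^sup>2 * (?D * ?t) + ?D * ?t"
    using marcus_tardos_step[OF \<pi> \<open>k > 0\<close> q A Suc.prems(2)] by (meson add_le_mono1 le_trans mult_le_mono2)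
  also have "\<dots> = ((k - 1)\<^sup>2 + 1) * (?D * ?t)" by simp
  also have "\<dots> \<le> k\<^sup>2 * (?D * ?t)"
  proof (rule mult_right_mono)
    obtain l where "k = Suc l" using \<open>k > 0\<close> gr0_implies_Suc by blast
    then show "(k - 1)\<^sup>2 + 1 \<le> k\<^sup>2" by (simp add: power2_eq_square)
  qed simp
  finally show ?case by (simp add: ac_simps)
qed

definition linear_avoidance_bound :: "nat \<Rightarrow> (nat \<Rightarrow> nat) \<Rightarrow> nat \<Rightarrow> bool" where
  "linear_avoidance_bound k \<pi> c \<longleftrightarrow>
     (\<forall>t A. A \<subseteq> {..<t} \<times> {..<t} \<longrightarrow> cop k \<pi> A = {} \<longrightarrow> card A \<le> c * t)"

theorem marcus_tardos:
  assumes \<pi>: "\<pi> permutes {1..k}" and "k > 1"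
  obtains c where "linear_avoidance_bound k \<pi> c"
proof
  let ?D = "2 * (k\<^sup>2)\<^sup>2 * k * (k\<^sup>2 choose k)"
  show "linear_avoidance_bound k \<pi> (?D * k\<^sup>2)"
    unfolding linear_avoidance_bound_def
  proof (intro allI impI)
    fix t A assume A: "A \<subseteq> {..<t} \<times> {..<t::nat}" and av: "cop k \<pi> A = {}"
    show "card A \<le> ?D * k\<^sup>2 * t"
    proof (cases "t = 0")
      case True then show ?thesis using A by simp
    next
      case False
      have "k\<^sup>2 \<ge> 2\<^sup>2" using \<open>k > 1\<close> by (intro power_mono) auto
      \<comment> \<open>Rounding \<open>t\<close> up to a power of \<open>k^2\<close> costs at most
        one more factor \<open>k^2\<close>.\<close>
      then obtain j where j: "(k\<^sup>2) ^ j \<le> t" "t < (k\<^sup>2) ^ (j + 1)"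
        using ex_power_ivl1[of "k\<^sup>2" t] False by auto
      have "card A \<le> ?D * (k\<^sup>2) ^ (j + 1)"
        by (rule marcus_tardos_power[OF \<pi> _ _ av]) (use A j \<open>k > 1\<close> in auto)
      also have "\<dots> = ?D * k\<^sup>2 * (k\<^sup>2) ^ j" by simp
      also have "\<dots> \<le> ?D * k\<^sup>2 * t" using j(1) by (rule mult_left_mono) simp
      finally show ?thesis .
    qed
  qed
qed

section \<open>Supersaturation by random sampling\<close>

text \<open>Deleting one point of a copy at a time destroys all copies within
  \<open>card (cop k \<pi> A)\<close> deletions, and what is left avoids the pattern.\<close>

lemma card_le_copies:
  assumes c: "linear_avoidance_bound k \<pi> c"
    and "k > 0" "A \<subseteq> {..<t} \<times> {..<t}"
  shows "card A \<le> c * t + card (cop k \<pi> A)"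
  using assms(3)
proof (induction "card (cop k \<pi> A)" arbitrary: A rule: less_induct)
  case less
  have fin: "finite A" using less.prems by (rule finite_subset) simp
  show ?case
  proof (cases "cop k \<pi> A = {}")
    case True then show ?thesis using c less.prems unfolding linear_avoidance_bound_def by simp
  next
    case False
    then obtain g where g: "g \<in> cop k \<pi> A" by blast
    have 1: "1 \<in> {1..k}" using \<open>k > 0\<close> by simp
    let ?A = "A - {g 1}"
    have "g \<notin> cop k \<pi> ?A" using copD(1)[OF _ 1] by blast
    then have lt: "card (cop k \<pi> ?A) < card (cop k \<pi> A)"
      using g cop_mono[of ?A A k \<pi>] by (intro psubset_card_mono finite_cop fin) auto
    moreover have "card ?A \<le> c * t + card (cop k \<pi> ?A)"
      by (rule less.hyps[OF lt]) (use less.prems in auto)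
    moreover have "card ?A = card A - 1" using copD(1)[OF g 1] by simp
    ultimately show ?thesis by linarith
  qed
qed

text \<open>The probability that a random subset of \<open>X\<close>, containing each element
  independently with probability \<open>p\<close>, equals \<open>S\<close>. Expectations become
  finite sums over \<open>Pow X\<close>.\<close>

definition sample_weight :: "real \<Rightarrow> 'a set \<Rightarrow> 'a set \<Rightarrow> real" where
  "sample_weight p X S = p ^ card S * (1 - p) ^ card (X - S)"

lemma sample_weight_nonneg: "0 \<le> p \<Longrightarrow> p \<le> 1 \<Longrightarrow> 0 \<le> sample_weight p X S"
  by (simp add: sample_weight_def)

text \<open>The probability that the sample contains \<open>T\<close>. It is obtained by expanding a
  product over \<open>X\<close> whose factors are \<open>p\<close> plus the weight of omission, set
  to \<open>0\<close> for points of \<open>T\<close>.\<close>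

lemma sum_sample_superset:
  assumes "finite X" "T \<subseteq> X"
  shows "(\<Sum>S\<in>Pow X. sample_weight p X S * of_bool (T \<subseteq> S)) = p ^ card T"
proof -
  have "p ^ card T = (\<Prod>x\<in>X. if x \<in> T then p else 1)"
    using assms by (simp add: prod.If_cases Int_absorb1)
  also have "\<dots> = (\<Prod>x\<in>X. p + (if x \<in> T then 0 else 1 - p))" by (intro prod.cong) auto
  also have "\<dots> = (\<Sum>S\<in>Pow X. (\<Prod>x\<in>S. p) * (\<Prod>x\<in>X - S. if x \<in> T then 0 else 1 - p))"
    by (rule prod_add[OF \<open>finite X\<close>])
  also have "\<dots> = (\<Sum>S\<in>Pow X. sample_weight p X S * of_bool (T \<subseteq> S))"
  proof (rule sum.cong[OF refl])
    fix S assume "S \<in> Pow X"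
    have fin: "finite (X - S)" using \<open>finite X\<close> by simp
    show "(\<Prod>x\<in>S. p) * (\<Prod>x\<in>X - S. if x \<in> T then 0 else 1 - p) = sample_weight p X S * of_bool (T \<subseteq> S)"
    proof (cases "T \<subseteq> S")
      case True
      then have "(\<Prod>x\<in>X - S. if x \<in> T then 0 else 1 - p) = (\<Prod>x\<in>X - S. 1 - p)" by (intro prod.cong) auto
      with True show ?thesis by (simp add: sample_weight_def)
    next
      case False
      then obtain x where x: "x \<in> X - S" "x \<in> T" using assms by blast
      then have "(\<Prod>x\<in>X - S. if x \<in> T then 0 else 1 - p) = 0" using fin by (auto intro!: prod_zero)
      then show ?thesis using False by simp
    qed
  qed
  finally show ?thesis by simp
qed

lemma sum_sample_weight: "finite X \<Longrightarrow> (\<Sum>S\<in>Pow X. sample_weight p X S) = 1"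
  using sum_sample_superset[of X "{}" p] by simp

text \<open>Complementing the sample exchanges \<open>p\<close> with \<open>1 - p\<close> and turns
  missing \<open>B\<close> into containing \<open>B\<close>.\<close>

lemma sum_sample_disjoint:
  assumes "finite X" "B \<subseteq> X"
  shows "(\<Sum>S\<in>Pow X. sample_weight p X S * of_bool (S \<inter> B = {})) = (1 - p) ^ card B"
proof -
  have "(\<Sum>S\<in>Pow X. sample_weight p X S * of_bool (S \<inter> B = {}))
      = (\<Sum>S\<in>Pow X. sample_weight (1 - p) X S * of_bool (B \<subseteq> S))"
  proof (rule sum.reindex_bij_witness[of _ "\<lambda>S. X - S" "\<lambda>S. X - S"])
    fix S assume "S \<in> Pow X"
    then show "sample_weight (1 - p) X (X - S) * of_bool (B \<subseteq> X - S) = sample_weight p X S * of_bool (S \<inter> B = {})"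
      using assms(2) by (auto simp: sample_weight_def double_diff)
  qed auto
  then show ?thesis using sum_sample_superset[OF assms] by simp
qed

text \<open>The left side is the probability that the sample hits a block of \<open>b\<close>
  points. Bernoulli's inequality and \<open>(1 - p) * (1 + p) \<le> 1\<close> give
  \<open>(1 - p) ^ b \<le> 1 / (1 + x)\<close> with \<open>x = b * p\<close>, and
  \<open>1 / (1 + x) \<le> 1 - min 1 x / 2\<close>.\<close>

lemma one_minus_power_ge:
  assumes "0 \<le> p" "p \<le> (1::real)"
  shows "1 - (1 - p) ^ b \<ge> min 1 (p * b) / 2"
proof -
  have "(1 - p) ^ b * (1 + b * p) \<le> (1 - p) ^ b * (1 + p) ^ b"
    using assms by (intro mult_left_mono Bernoulli_inequality) auto
  also have "\<dots> = (1 - p\<^sup>2) ^ b" by (simp add: power_mult_distrib[symmetric] algebra_simps power2_eq_square)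
  also have "\<dots> \<le> 1" using assms by (intro power_le_one) (auto simp: power_le_one)
  finally have *: "(1 - p) ^ b * (1 + b * p) \<le> 1" .
  have pb: "0 \<le> b * p" using assms by simp
  have "(1 - min 1 (p * b) / 2) * (1 + b * p) \<ge> 1"
  proof (cases "p * b \<le> 1")
    case True
    have "b * p * (b * p) \<le> b * p * 1" using True pb by (intro mult_left_mono) (auto simp: mult.commute)
    then show ?thesis using True by (simp add: algebra_simps)
  qed (auto simp: algebra_simps)
  then have "(1 - p) ^ b * (1 + b * p) \<le> (1 - min 1 (p * b) / 2) * (1 + b * p)" using * by linarith
  then have "(1 - p) ^ b \<le> 1 - min 1 (p * b) / 2"
    by (rule mult_right_le_imp_le) (use pb in linarith)
  then show ?thesis by simp
qed

lemma contr_sample: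
  assumes "S \<subseteq> X" shows "contr q S = {b \<in> contr q X. S \<inter> block q X b \<noteq> {}}"
proof (intro set_eqI iffI)
  fix b assume "b \<in> contr q S"
  then obtain a where "a \<in> S" "b = cell q a" unfolding contr_def by blast
  then have "a \<in> S \<inter> block q X b" using assms by (simp add: block_def subsetD)
  then show "b \<in> {b \<in> contr q X. S \<inter> block q X b \<noteq> {}}" using contr_iff_block by blast
next
  fix b assume "b \<in> {b \<in> contr q X. S \<inter> block q X b \<noteq> {}}"
  then obtain a where "a \<in> S" "cell q a = b" unfolding block_def by blast
  then show "b \<in> contr q S" unfolding contr_def by blast
qed

lemma cop_sample:
  assumes "S \<subseteq> X" shows "cop k \<pi> S = {g \<in> cop k \<pi> X. g ` {1..k} \<subseteq> S}"
  using assms cop_mono[OF assms] unfolding cop_def by (auto simp: PiE_iff image_subset_iff)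

text \<open>Take expectations in \<open>card_le_copies\<close> for the contraction of a random
  sample. A cell counts with the probability that its block is hit, a copy survives with probability
  \<open>p ^ k\<close>, and contraction creates no copies. The free parameter \<open>p\<close> can
  be tuned until few copies survive.\<close>

lemma supersaturation:
  fixes p :: real
  assumes c: "linear_avoidance_bound k \<pi> c"
    and \<pi>: "inj_on \<pi> {1..k}" and "k > 0" "finite X" and X: "contr q X \<subseteq> {..<t} \<times> {..<t}"
    and p: "0 \<le> p" "p \<le> 1"
  shows "(\<Sum>b\<in>contr q X. min 1 (p * card (block q X b))) \<le> 2 * (real c * real t + p ^ k * real (card (cop k \<pi> X)))"
proof -
  let ?w = "sample_weight p X"
  have fin: "finite (contr q X)" "finite (cop k \<pi> X)"
    using \<open>finite X\<close> finite_contr finite_cop by blast+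
  have le: "card (contr q S) \<le> c * t + card (cop k \<pi> S)" if "S \<in> Pow X" for S
  proof -
    have "contr q S \<subseteq> contr q X" using that by (auto simp: contr_def)
    then have "card (contr q S) \<le> c * t + card (cop k \<pi> (contr q S))"
      using card_le_copies[OF c \<open>k > 0\<close>] X by blast
    also have "\<dots> \<le> c * t + card (cop k \<pi> S)"
      using card_cop_contr[OF \<pi>, of S q] that \<open>finite X\<close> by (auto intro: finite_subset)
    finally show ?thesis .
  qed
  have "(\<Sum>b\<in>contr q X. min 1 (p * card (block q X b)) / 2)
      \<le> (\<Sum>b\<in>contr q X. 1 - (1 - p) ^ card (block q X b))"
    by (intro sum_mono one_minus_power_ge p)
  also have "\<dots> = (\<Sum>b\<in>contr q X. \<Sum>S\<in>Pow X. ?w S * of_bool (S \<inter> block q X b \<noteq> {}))"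
  proof (rule sum.cong[OF refl])
    fix b
    have "(\<Sum>S\<in>Pow X. ?w S * of_bool (S \<inter> block q X b \<noteq> {}))
        = (\<Sum>S\<in>Pow X. ?w S - ?w S * of_bool (S \<inter> block q X b = {}))"
      by (intro sum.cong) auto
    then show "1 - (1 - p) ^ card (block q X b) = (\<Sum>S\<in>Pow X. ?w S * of_bool (S \<inter> block q X b \<noteq> {}))"
      using sum_sample_weight[OF \<open>finite X\<close>, of p] sum_sample_disjoint[OF \<open>finite X\<close> block_subset, of p q b]
      by (simp add: sum_subtractf)
  qed
  also have "\<dots> = (\<Sum>S\<in>Pow X. ?w S * (\<Sum>b\<in>contr q X. of_bool (S \<inter> block q X b \<noteq> {})))"
    by (subst sum.swap) (simp add: sum_distrib_left)
  also have "\<dots> = (\<Sum>S\<in>Pow X. ?w S * card (contr q S))"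
    using fin by (intro sum.cong refl) (simp add: contr_sample Int_def)
  also have "\<dots> \<le> (\<Sum>S\<in>Pow X. ?w S * (c * t + card (cop k \<pi> S)))"
  proof (rule sum_mono)
    fix S assume "S \<in> Pow X"
    then show "?w S * card (contr q S) \<le> ?w S * (c * t + card (cop k \<pi> S))"
      using le[of S] sample_weight_nonneg[OF p] by (intro mult_left_mono) (simp_all flip: of_nat_mult of_nat_add)
  qed
  also have "\<dots> = c * t + (\<Sum>S\<in>Pow X. ?w S * card (cop k \<pi> S))"
    using sum_sample_weight[OF \<open>finite X\<close>, of p]
    by (simp add: distrib_left sum.distrib flip: sum_distrib_right)
  also have "(\<Sum>S\<in>Pow X. ?w S * card (cop k \<pi> S))
      = (\<Sum>S\<in>Pow X. ?w S * (\<Sum>g\<in>cop k \<pi> X. of_bool (g ` {1..k} \<subseteq> S)))"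
    using fin by (intro sum.cong refl) (simp add: cop_sample Int_def)
  also have "\<dots> = (\<Sum>g\<in>cop k \<pi> X. \<Sum>S\<in>Pow X. ?w S * of_bool (g ` {1..k} \<subseteq> S))"
    by (subst sum.swap) (simp add: sum_distrib_left)
  also have "\<dots> = (\<Sum>g\<in>cop k \<pi> X. p ^ k)"
  proof (rule sum.cong[OF refl])
    fix g assume g: "g \<in> cop k \<pi> X"
    have "g ` {1..k} \<subseteq> X" using copD(1)[OF g] by blast
    then show "(\<Sum>S\<in>Pow X. ?w S * of_bool (g ` {1..k} \<subseteq> S)) = p ^ k"
      using sum_sample_superset[OF \<open>finite X\<close>] card_image[OF cop_inj_on[OF g]] by simp
  qed
  finally show ?thesis by (simp add: sum_divide_distrib[symmetric] mult.commute)
qed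

text \<open>The threshold is an expected number of at least one sampled point in the cell, which is
  where the minimum in \<open>supersaturation\<close> changes from one value to the other.\<close>

definition heavy :: "real \<Rightarrow> nat \<Rightarrow> (nat \<times> nat) set \<Rightarrow> (nat \<times> nat) set" where
  "heavy p q X = {b \<in> contr q X. 1 \<le> p * card (block q X b)}"

definition light_points :: "real \<Rightarrow> nat \<Rightarrow> (nat \<times> nat) set \<Rightarrow> (nat \<times> nat) set" where
  "light_points p q X = {a \<in> X. cell q a \<notin> heavy p q X}"

text \<open>Both estimates read off the same sum: a heavy cell contributes \<open>1\<close> to it,
  any other cell \<open>p\<close> times its number of points.\<close>

lemma heavy_light_bounds:
  fixes p :: real
  assumes c: "linear_avoidance_bound k \<pi> c"
    and \<pi>: "inj_on \<pi> {1..k}" and "k > 0" "finite X" and X: "contr q X \<subseteq> {..<t} \<times> {..<t}"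
    and p: "0 \<le> p" "p \<le> (1::real)"
  shows "real (card (heavy p q X)) \<le> 2 * (real c * real t + p ^ k * real (card (cop k \<pi> X)))"
    and "p * real (card (light_points p q X)) \<le> 2 * (real c * real t + p ^ k * real (card (cop k \<pi> X)))"
proof -
  note le = supersaturation[OF c \<pi> \<open>k > 0\<close> \<open>finite X\<close> X p]
  let ?f = "\<lambda>b. min 1 (p * card (block q X b))"
  have fin: "finite (contr q X)" using \<open>finite X\<close> by (rule finite_contr)
  have sub: "heavy p q X \<subseteq> contr q X" by (auto simp: heavy_def)
  have "real (card (heavy p q X)) = sum ?f (heavy p q X)" by (simp add: heavy_def)
  also have "\<dots> \<le> sum ?f (contr q X)" using fin sub p by (intro sum_mono2) auto
  finally show "real (card (heavy p q X)) \<le> 2 * (real c * real t + p ^ k * real (card (cop k \<pi> X)))" using le by linarith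
  have "light_points p q X = (\<Union>b\<in>contr q X - heavy p q X. block q X b)"
  proof (rule set_eqI)
    fix a show "a \<in> light_points p q X \<longleftrightarrow> a \<in> (\<Union>b\<in>contr q X - heavy p q X. block q X b)"
      by (simp add: light_points_def block_def contr_def) (metis imageI)
  qed
  then have "card (light_points p q X) \<le> (\<Sum>b\<in>contr q X - heavy p q X. card (block q X b))"
    using fin card_UN_le by (metis finite_Diff)
  then have "real (card (light_points p q X)) \<le> (\<Sum>b\<in>contr q X - heavy p q X. real (card (block q X b)))"
    by (metis of_nat_le_iff of_nat_sum)
  then have "p * real (card (light_points p q X)) \<le> p * (\<Sum>b\<in>contr q X - heavy p q X. real (card (block q X b)))"
    using p by (intro mult_left_mono)
  also have "\<dots> = sum ?f (contr q X - heavy p q X)"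
    unfolding sum_distrib_left by (rule sum.cong) (auto simp: heavy_def)
  also have "\<dots> \<le> sum ?f (contr q X)" using fin p by (intro sum_mono2) auto
  finally show "p * real (card (light_points p q X)) \<le> 2 * (real c * real t + p ^ k * real (card (cop k \<pi> X)))" using le by linarith
qed

section \<open>Counting point sets that are sparse at every scale\<close>

text \<open>For finite \<open>D\<close> and \<open>R\<close> of equal size these are graphs of
  bijections from \<open>D\<close> to \<open>R\<close>. Such sets arise because the light points of
  a permutation occupy arbitrary columns and rows.\<close>

definition partial_perms ::
    "nat \<Rightarrow> (nat \<Rightarrow> nat) \<Rightarrow> nat set \<Rightarrow> nat set \<Rightarrow> nat \<Rightarrow> (nat \<times> nat) set set" where
  "partial_perms k \<pi> D R m =
     {\<Gamma>. \<Gamma> \<subseteq> D \<times> R \<and> inj_on fst \<Gamma> \<and> inj_on snd \<Gamma> \<and> card \<Gamma> = card D \<and> card (cop k \<pi> \<Gamma>) \<le> m}"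

lemma finite_partial_perms: "finite D \<Longrightarrow> finite R \<Longrightarrow> finite (partial_perms k \<pi> D R m)"
  by (rule finite_subset[of _ "Pow (D \<times> R)"]) (auto simp: partial_perms_def)

lemma rank_mono: "finite D \<Longrightarrow> mono (\<lambda>x::nat. card {y\<in>D. y < x})"
  by (intro monoI card_mono) auto

lemma rank_strict:
  assumes "finite D" "x \<in> D" "x < (y::nat)"
  shows "card {z\<in>D. z < x} < card {z\<in>D. z < y}"
  by (rule psubset_card_mono) (use assms in auto)

lemma rank_inj: "finite D \<Longrightarrow> inj_on (\<lambda>x::nat. card {y\<in>D. y < x}) D"
  by (rule inj_onI) (metis less_irrefl_nat linorder_less_linear rank_strict)

lemma rank_less: "finite D \<Longrightarrow> x \<in> D \<Longrightarrow> card {y\<in>D. y < (x::nat)} < card D"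
  by (rule psubset_card_mono) auto

text \<open>Replace every coordinate by its rank in \<open>D\<close> or \<open>R\<close>. Ranks are
  monotone everywhere, so no copies are added, and injective on \<open>D\<close> and
  \<open>R\<close>, so no point set is lost.\<close>

lemma card_partial_perms_standardize:
  assumes "inj_on \<pi> {1..k}" and fin: "finite D" "finite R" and n: "card D = n" "card R = n"
  shows "card (partial_perms k \<pi> D R m) \<le> card (partial_perms k \<pi> {..<n} {..<n} m)"
proof -
  define u where "u = (\<lambda>x::nat. card {y\<in>D. y < x})"
  define v where "v = (\<lambda>x::nat. card {y\<in>R. y < x})"
  have u: "mono u" "inj_on u D" "u ` D \<subseteq> {..<n}"
    using rank_mono[OF fin(1)] rank_inj[OF fin(1)] rank_less[OF fin(1)]
    unfolding u_def n(1) by (auto simp: image_subset_iff)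
  have v: "mono v" "inj_on v R" "v ` R \<subseteq> {..<n}"
    using rank_mono[OF fin(2)] rank_inj[OF fin(2)] rank_less[OF fin(2)]
    unfolding v_def n(2) by (auto simp: image_subset_iff)
  let ?f = "map_prod u v"
  have inj: "inj_on ?f (D \<times> R)" using u v by (intro map_prod_inj_on)
  show ?thesis
  proof (rule card_inj_on_le)
    show "inj_on (image ?f) (partial_perms k \<pi> D R m)"
      by (rule inj_on_subset[OF inj_on_image_Pow[OF inj]]) (auto simp: partial_perms_def)
    show "image ?f ` partial_perms k \<pi> D R m \<subseteq> partial_perms k \<pi> {..<n} {..<n} m"
    proof (rule image_subsetI)
      fix \<Gamma> assume G: "\<Gamma> \<in> partial_perms k \<pi> D R m"
      then have sub: "\<Gamma> \<subseteq> D \<times> R" and fs: "inj_on fst \<Gamma>" "inj_on snd \<Gamma>"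
        and c: "card \<Gamma> = card D" "card (cop k \<pi> \<Gamma>) \<le> m"
        unfolding partial_perms_def by auto
      have fG: "finite \<Gamma>" using sub fin by (meson finite_SigmaI finite_subset)
      have "fst ` \<Gamma> \<subseteq> D" "snd ` \<Gamma> \<subseteq> R" using sub by auto
      then have "inj_on (u \<circ> fst) \<Gamma>" "inj_on (v \<circ> snd) \<Gamma>"
        using fs u(2) v(2) by (auto intro: comp_inj_on inj_on_subset)
      then have "inj_on (fst \<circ> ?f) \<Gamma>" "inj_on (snd \<circ> ?f) \<Gamma>" by simp_all
      then have "inj_on fst (?f ` \<Gamma>)" "inj_on snd (?f ` \<Gamma>)" by (auto intro: inj_on_imageI)
      moreover have "card (?f ` \<Gamma>) = n"
        using card_image[OF inj_on_subset[OF inj sub]] c n by simp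
      moreover have "?f ` \<Gamma> \<subseteq> {..<n} \<times> {..<n}" using sub u(3) v(3) by fastforce
      moreover have "card (cop k \<pi> (?f ` \<Gamma>)) \<le> m"
        using card_cop_image[OF assms(1) fG u(1) v(1)] c(2) by linarith
      ultimately show "?f ` \<Gamma> \<in> partial_perms k \<pi> {..<n} {..<n} m"
        unfolding partial_perms_def by simp
    qed
  qed (simp add: finite_partial_perms)
qed

text \<open>The cap \<open>min n\<close> makes the condition reasonable for every \<open>i\<close>:
  from scale \<open>n\<close> on at most one cell is left, and it costs at most \<open>n\<close>.
  Having all \<open>i\<close> in the condition lets it pass from \<open>l\<close> to
  \<open>2 * l\<close> by a shift.\<close>

definition scale_sparse :: "nat \<Rightarrow> nat \<Rightarrow> nat \<Rightarrow> (nat \<times> nat) set set" where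
  "scale_sparse c n l = {N. N \<subseteq> {..<n} \<times> {..<n} \<and> (\<forall>i. min n (2 ^ i * l) * card (contr (2 ^ i * l) N) \<le> c * n)}"

lemma finite_scale_sparse: "finite (scale_sparse c n l)"
  by (rule finite_subset[of _ "Pow ({..<n} \<times> {..<n})"]) (auto simp: scale_sparse_def)

lemma scale_sparse_finite: "N \<in> scale_sparse c n l \<Longrightarrow> finite N"
  unfolding scale_sparse_def by (elim CollectE conjE) (rule finite_subset, auto)

lemma scale_sparse_double: "scale_sparse c n l \<subseteq> scale_sparse c n (2 * l)"
proof
  fix N assume N: "N \<in> scale_sparse c n l"
  have "min n (2 ^ i * (2 * l)) * card (contr (2 ^ i * (2 * l)) N) \<le> c * n" for i
    using N unfolding scale_sparse_def by (auto dest!: spec[of _ "Suc i"] simp: ac_simps)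
  with N show "N \<in> scale_sparse c n (2 * l)" unfolding scale_sparse_def by simp
qed

lemma scale_sparse_card: "N \<in> scale_sparse c n l \<Longrightarrow> min n l * card (contr l N) \<le> c * n"
  unfolding scale_sparse_def by (auto dest!: spec[of _ 0])

lemma contr_contr: "contr q (contr l N) = contr (q * l) N"
  by (force simp: contr_def image_image cell_eq div_mult2_eq mult.commute[of q l])

lemma card_cell_vimage:
  assumes "q > 0" "finite M" shows "finite {p. cell q p \<in> M}" "card {p. cell q p \<in> M} \<le> q\<^sup>2 * card M"
proof -
  have eq: "{p. cell q p \<in> M} = (\<Union>b\<in>M. {x. x div q = fst b} \<times> {y. y div q = snd b})"
    by (auto simp: cell_eq)
  show "finite {p. cell q p \<in> M}" unfolding eq using assms by (simp add: card_div_fibre)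
  have "card {p. cell q p \<in> M} \<le> (\<Sum>b\<in>M. card ({x. x div q = fst b} \<times> {y. y div q = snd b}))"
    unfolding eq by (rule card_UN_le[OF assms(2)])
  also have "\<dots> = q\<^sup>2 * card M"
    using assms(1) by (simp add: card_div_fibre card_cartesian_product power2_eq_square)
  finally show "card {p. cell q p \<in> M} \<le> q\<^sup>2 * card M" .
qed

lemma contr_large:
  assumes "N \<subseteq> {..<n} \<times> {..<n}" "n \<le> l" shows "contr l N \<subseteq> {(0, 0)}"
  using assms unfolding contr_def by (auto simp: cell_eq)

text \<open>Given a contraction by \<open>2 l\<close> with \<open>w\<close> cells, the contraction by \<open>l\<close> lives on the \<open>4 w\<close> subcells, so
  there are at most \<open>16 ^ w\<close> choices; the exponents \<open>w\<close> form a geometric series over the scales.\<close>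

lemma card_scale_sparse_contr:
  assumes "l > 0"
  shows "real (card (contr l ` scale_sparse c n l)) \<le> 2 * 16 powr (2 * real c * real n / real l)"
  using assms
\<comment> \<open>Fine scales are reduced to coarse ones: doubling \<open>l\<close> decreases
  \<open>n - l\<close> as long as \<open>l < n\<close>.\<close>
proof (induction "n - l" arbitrary: l rule: less_induct)
  case less
  show ?case
  proof (cases "n \<le> l")
    case True
    have "contr l ` scale_sparse c n l \<subseteq> Pow {(0, 0)}"
      using contr_large[OF _ True] unfolding scale_sparse_def by blast
    then have "card (contr l ` scale_sparse c n l) \<le> card (Pow {(0::nat, 0::nat)})" by (intro card_mono) auto
    then have "real (card (contr l ` scale_sparse c n l)) \<le> 2 * 1" by (simp add: card_Pow)
    also have "\<dots> \<le> 2 * 16 powr (2 * real c * real n / real l)" by (intro mult_left_mono) (auto intro: ge_one_powr_ge_zero)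
    finally show ?thesis .
  next
    case False
    let ?S = "contr (2 * l) ` scale_sparse c n (2 * l)" and ?ch = "\<lambda>M. {p. cell 2 p \<in> M}"
    have finM: "finite M" if "M \<in> ?S" for M
      using that scale_sparse_finite finite_contr by blast
    have cardM: "16 ^ card M \<le> (16::real) powr (real c * real n / real l)" if M: "M \<in> ?S" for M
    proof -
      obtain N where "N \<in> scale_sparse c n (2 * l)" "M = contr (2 * l) N" using M by blast
      then have "min n (2 * l) * card M \<le> c * n" using scale_sparse_card by blast
      \<comment> \<open>As \<open>l < n\<close>, the cap stays at least \<open>l\<close> even when
        \<open>2 * l\<close> exceeds \<open>n\<close>.\<close>
      moreover have "l \<le> min n (2 * l)" using False by simp
      ultimately have "l * card M \<le> c * n" by (meson le_trans mult_le_mono1)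
      then have "real (card M) * real l \<le> real c * real n"
        by (metis mult.commute of_nat_le_iff of_nat_mult)
      then have "real (card M) \<le> real c * real n / real l" using less.prems by (simp add: pos_le_divide_eq)
      then show ?thesis by (simp flip: powr_realpow)
    qed
    have "contr l ` scale_sparse c n l \<subseteq> (\<Union>M\<in>?S. Pow (?ch M))"
    proof (rule image_subsetI)
      fix N assume N: "N \<in> scale_sparse c n l"
      have "contr (2 * l) N \<in> ?S" using N scale_sparse_double by blast
      moreover have "contr l N \<subseteq> ?ch (contr (2 * l) N)"
        unfolding contr_contr[symmetric] by (auto simp: contr_def)
      ultimately show "contr l N \<in> (\<Union>M\<in>?S. Pow (?ch M))" by blast
    qed
    moreover have finS: "finite ?S" using finite_scale_sparse by blast
    moreover have "finite (\<Union>M\<in>?S. Pow (?ch M))"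
      by (rule finite_UN_I[OF finS]) (use finM card_cell_vimage(1)[of 2] in simp)
    ultimately have "card (contr l ` scale_sparse c n l) \<le> (\<Sum>M\<in>?S. card (Pow (?ch M)))"
      using card_UN_le[OF finS, of "\<lambda>M. Pow (?ch M)"] card_mono by (meson le_trans)
    also have "\<dots> \<le> (\<Sum>M\<in>?S. 16 ^ card M)"
    proof (rule sum_mono)
      fix M assume M: "M \<in> ?S"
      have "card (Pow (?ch M)) = 2 ^ card (?ch M)"
        using card_cell_vimage(1)[of 2 M] finM[OF M] by (simp add: card_Pow)
      also have "\<dots> \<le> 2 ^ (4 * card M)"
        using card_cell_vimage(2)[of 2 M] finM[OF M] by (intro power_increasing) auto
      finally show "card (Pow (?ch M)) \<le> 16 ^ card M" by (simp add: power_mult)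
    qed
    finally have "real (card (contr l ` scale_sparse c n l)) \<le> real (\<Sum>M\<in>?S. 16 ^ card M)" by (simp only: of_nat_le_iff)
    also have "\<dots> = (\<Sum>M\<in>?S. 16 ^ card M)" by simp
    also have "\<dots> \<le> of_nat (card ?S) * 16 powr (real c * real n / real l)" by (rule sum_bounded_above) (rule cardM)
    also have "\<dots> \<le> (2 * 16 powr (2 * real c * real n / real (2 * l))) * 16 powr (real c * real n / real l)"
    proof (rule mult_right_mono)
      show "real (card ?S) \<le> 2 * 16 powr (2 * real c * real n / real (2 * l))"
        using less.hyps[of "2 * l"] less.prems False by simp
    qed simp
    also have "\<dots> = 2 * 16 powr (2 * real c * real n / real (2 * l) + real c * real n / real l)" by (simp only: powr_add mult.assoc)
    \<comment> \<open>The exponent sums the costs \<open>c n / (2^i l)\<close> over all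
      \<open>i\<close>; hence its factor \<open>2\<close>.\<close>
    also have "2 * real c * real n / real (2 * l) + real c * real n / real l = 2 * real c * real n / real l"
      using less.prems by (simp add: field_simps)
    finally show ?thesis .
  qed
qed

text \<open>If \<open>d\<close> cells of \<open>M\<close> lie over the column \<open>x\<close>, the
  graph has at most \<open>l * d\<close> heights there. The estimate \<open>d \<le> 2 ^ d\<close>
  turns the product over the columns into a sum in the exponent, where each cell of \<open>M\<close>
  is counted by at most \<open>min n l\<close> columns.\<close>

lemma card_graphs_with_contr:
  assumes "l > 0" "finite M" "D \<subseteq> {..<n}"
  shows "card {N. inj_on fst N \<and> fst ` N = D \<and> contr l N = M} \<le> l ^ card D * 2 ^ (min n l * card M)"
    and "finite {N. inj_on fst N \<and> fst ` N = D \<and> contr l N = M}"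
proof -
  let ?d = "\<lambda>x. {r. (x div l, r) \<in> M}"
  let ?Y = "\<lambda>x. {y. (x div l, y div l) \<in> M}"
  let ?S = "{N. inj_on fst N \<and> fst ` N = D \<and> contr l N = M}"
  have finD: "finite D" using assms(3) finite_subset by blast
  have find: "finite (?d x)" for x
    by (rule finite_subset[of _ "snd ` M"]) (use assms in force)+
  have Yeq: "?Y x = (\<Union>r\<in>?d x. {y. y div l = r})" for x by auto
  have finY: "finite (?Y x)" for x unfolding Yeq using find assms by (auto simp: card_div_fibre)
  have cardY: "card (?Y x) \<le> l * 2 ^ card (?d x)" for x
  proof -
    have "card (?Y x) \<le> (\<Sum>r\<in>?d x. card {y. y div l = r})" unfolding Yeq by (rule card_UN_le[OF find])
    also have "\<dots> = l * card (?d x)" using assms by (simp add: card_div_fibre)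
    also have "\<dots> \<le> l * 2 ^ card (?d x)" by (intro mult_left_mono) (auto simp: less_imp_le)
    finally show ?thesis .
  qed
  have sub: "?S \<subseteq> (\<lambda>f. (\<lambda>x. (x, f x)) ` D) ` (PiE D ?Y)"
  proof
    fix N assume "N \<in> ?S"
    then have N: "inj_on fst N" "fst ` N = D" "contr l N = M" by auto
    define f where "f = restrict (\<lambda>x. snd (inv_into N fst x)) D"
    have f: "(x, f x) \<in> N" if "x \<in> D" for x
      using that N inv_into_into[of x fst N] f_inv_into_f[of x fst N]
      by (metis f_def prod.collapse restrict_apply')
    have "(\<lambda>x. (x, f x)) ` D = N"
    proof
      show "(\<lambda>x. (x, f x)) ` D \<subseteq> N" using f by blast
      show "N \<subseteq> (\<lambda>x. (x, f x)) ` D"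
      proof
        fix a assume a: "a \<in> N"
        then have "fst a \<in> D" using N by blast
        then have "(fst a, f (fst a)) \<in> N" by (rule f)
        then have "a = (fst a, f (fst a))" using a inj_onD[OF N(1)] by (metis fst_conv)
        then show "a \<in> (\<lambda>x. (x, f x)) ` D" using \<open>fst a \<in> D\<close> by (rule image_eqI)
      qed
    qed
    moreover have "f \<in> PiE D ?Y"
    proof (rule PiE_I)
      fix x assume "x \<in> D"
      then have "cell l (x, f x) \<in> contr l N" unfolding contr_def by (intro imageI f)
      then show "f x \<in> ?Y x" using N(3) by simp
    qed (simp add: f_def)
    ultimately show "N \<in> (\<lambda>f. (\<lambda>x. (x, f x)) ` D) ` (PiE D ?Y)" by blast
  qed
  have finP: "finite (PiE D ?Y)" using finD finY by (rule finite_PiE)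
  show "finite ?S" using finP sub by (meson finite_imageI finite_subset)
  have "card ?S \<le> card (PiE D ?Y)"
    using sub finP by (meson card_image_le card_mono finite_imageI le_trans)
  also have "\<dots> = (\<Prod>x\<in>D. card (?Y x))" by (rule card_PiE[OF finD])
  also have "\<dots> \<le> (\<Prod>x\<in>D. l * 2 ^ card (?d x))" by (intro prod_mono) (simp add: cardY)
  also have "\<dots> = l ^ card D * 2 ^ (\<Sum>x\<in>D. card (?d x))" by (simp add: prod.distrib power_sum)
  also have "\<dots> \<le> l ^ card D * 2 ^ (min n l * card M)"
  proof (intro mult_left_mono power_increasing)
    have "(\<Sum>x\<in>D. card (?d x)) \<le> (\<Sum>x<n. card (?d x))" by (rule sum_mono2) (use assms in auto)
    also have "\<dots> = (\<Sum>x<n. \<Sum>b\<in>M. if fst b = x div l then 1 else 0)"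
    proof (rule sum.cong[OF refl])
      fix x
      have "?d x = snd ` {b \<in> M. fst b = x div l}" by force
      moreover have "inj_on snd {b \<in> M. fst b = x div l}" by (auto simp: inj_on_def)
      ultimately have "card (?d x) = card {b \<in> M. fst b = x div l}" by (simp add: card_image)
      then show "card (?d x) = (\<Sum>b\<in>M. if fst b = x div l then 1 else 0)"
        using assms by (simp flip: sum.inter_filter)
    qed
    also have "\<dots> = (\<Sum>b\<in>M. \<Sum>x<n. if fst b = x div l then 1 else 0)" by (rule sum.swap)
    also have "\<dots> \<le> of_nat (card M) * min n l"
    proof (rule sum_bounded_above)
      fix b :: "nat \<times> nat"
      have "(\<Sum>x<n. if fst b = x div l then 1 else 0) = card {x \<in> {..<n}. fst b = x div l}"
        by (simp flip: sum.inter_filter)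
      moreover have "card {x \<in> {..<n}. fst b = x div l} \<le> card {..<n}" by (intro card_mono) auto
      moreover have "card {x \<in> {..<n}. fst b = x div l} \<le> card {x. x div l = fst b}"
        using assms by (intro card_mono) (simp add: card_div_fibre, auto)
      ultimately show "(\<Sum>x<n. if fst b = x div l then 1 else 0) \<le> min n l"
        using assms by (simp add: card_div_fibre)
    qed
    finally show "(\<Sum>x\<in>D. card (?d x)) \<le> min n l * card M" by (simp add: mult.commute)
  qed auto
  finally show "card ?S \<le> l ^ card D * 2 ^ (min n l * card M)" .
qed

lemma card_scale_sparse_graphs:
  assumes "l > 0" "D \<subseteq> {..<n}"
  shows "real (card {N \<in> scale_sparse c n l. inj_on fst N \<and> fst ` N = D})
    \<le> 2 * 16 powr (2 * real c * real n / real l) * (real l ^ card D * 2 ^ (c * n))"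
proof -
  let ?S = "{N \<in> scale_sparse c n l. inj_on fst N \<and> fst ` N = D}"
  let ?F = "\<lambda>M. {N. inj_on fst N \<and> fst ` N = D \<and> contr l N = M}"
  let ?C = "contr l ` scale_sparse c n l"
  have finC: "finite ?C" using finite_scale_sparse by blast
  have M: "finite M" "min n l * card M \<le> c * n" if "M \<in> ?C" for M
    using that scale_sparse_card scale_sparse_finite finite_contr by blast+
  have "card ?S \<le> card (\<Union>M\<in>?C. ?F M)"
    by (rule card_mono[OF finite_UN_I[OF finC card_graphs_with_contr(2)[OF assms(1) M(1) assms(2)]]]) auto
  also have "\<dots> \<le> (\<Sum>M\<in>?C. card (?F M))" by (rule card_UN_le[OF finC])
  also have "\<dots> \<le> of_nat (card ?C) * (l ^ card D * 2 ^ (c * n))"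
  proof (rule sum_bounded_above)
    fix M assume "M \<in> ?C"
    note card_graphs_with_contr(1)[OF assms(1) M(1)[OF this] assms(2)]
    also have "l ^ card D * 2 ^ (min n l * card M) \<le> l ^ card D * 2 ^ (c * n)"
      using M(2)[OF \<open>M \<in> ?C\<close>] by (intro mult_left_mono power_increasing) auto
    finally show "card (?F M) \<le> l ^ card D * 2 ^ (c * n)" .
  qed
  finally have "real (card ?S) \<le> real (card ?C * (l ^ card D * 2 ^ (c * n)))" by (simp only: of_nat_le_iff of_nat_id)
  also have "\<dots> = real (card ?C) * (real l ^ card D * 2 ^ (c * n))" by simp
  also have "\<dots> \<le> 2 * 16 powr (2 * real c * real n / real l) * (real l ^ card D * 2 ^ (c * n))"
    by (intro mult_right_mono card_scale_sparse_contr assms) auto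
  finally show ?thesis .
qed

section \<open>The upper bound\<close>

text \<open>For \<open>p = Q / l\<close> the hypotheses on \<open>Q\<close> say that
  \<open>p \<le> 1\<close> and that at most \<open>n / l\<close> copies are expected to survive at
  scale \<open>l\<close>. The factor \<open>(5/8) ^ i\<close> carries this over to
  \<open>n / q\<close> copies at scale \<open>q\<close>.\<close>

lemma scale_bounds:
  fixes c n m l k i :: nat
  assumes c: "linear_avoidance_bound k \<pi> c"
    and \<pi>: "inj_on \<pi> {1..k}" and "k > 1" and X: "X \<subseteq> {..<n} \<times> {..<n}" "card (cop k \<pi> X) \<le> m"
    and Q: "Q = 10 * (4 * real c + 2)" "Q \<le> real l" "real m * Q ^ k \<le> real n * real l ^ (k - 1)"
    and q: "q = 2 ^ i * l" "q \<le> n" and p: "p = Q * (5/8) ^ i / real l"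
  shows "q * card (heavy p q X) \<le> (4 * c + 2) * n"
    and "real (card (light_points p q X)) \<le> real n / 10 * (4/5) ^ i"
proof -
  \<comment> \<open>\<open>t\<close> cells suffice along each side, and \<open>q \<le> n\<close>
    gives \<open>q * t \<le> 2 * n\<close>.\<close>
  define t where "t = n div q + 1"
  have fin: "finite X" using X(1) finite_subset by blast
  have Q0: "Q > 0" using Q(1) by simp
  then have l0: "real l > 0" using Q(2) by linarith
  then have q0: "q > 0" using q(1) by simp
  have p0: "0 \<le> p" using p Q0 l0 by simp
  have "Q / real l * (5/8) ^ i \<le> 1 * 1"
    using Q Q0 l0 by (intro mult_mono power_le_one) (auto simp: divide_le_eq)
  then have p1: "p \<le> 1" using p by simp
  have "contr q X \<subseteq> {..<t} \<times> {..<t}"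
    using X(1) unfolding contr_def t_def by (fastforce simp: cell_eq less_Suc_eq_le intro!: div_le_mono)
  note hl = heavy_light_bounds[OF c \<pi> _ fin this p0 p1]
  have "q * (n div q) \<le> n" by simp
  then have "q * t \<le> 2 * n" using q(2) unfolding t_def distrib_left by linarith
  then have qt: "real q * real t \<le> 2 * real n" by (simp flip: of_nat_mult of_nat_le_iff)
  \<comment> \<open>Since \<open>(5/8)^2 \<le> 1/2\<close>, the decay of \<open>p ^ k\<close>
    offsets the doubling of the cells for every \<open>k \<ge> 2\<close>.\<close>
  have pow: "((5/8::real) ^ i) ^ k \<le> (1/2) ^ i"
  proof -
    have "((5/8::real) ^ i) ^ k \<le> ((5/8) ^ i)\<^sup>2"
      using \<open>k > 1\<close> by (intro power_decreasing) (auto simp: power_le_one)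
    also have "\<dots> = (25/64) ^ i" by (simp add: power2_eq_square flip: power_mult_distrib)
    also have "\<dots> \<le> (1/2) ^ i" by (intro power_mono) auto
    finally show ?thesis .
  qed
  have "p ^ k * real (card (cop k \<pi> X)) \<le> p ^ k * real m"
    using X(2) p0 by (intro mult_left_mono) auto
  also have "\<dots> = real m * Q ^ k * ((5/8) ^ i) ^ k / real l ^ k"
    unfolding p by (simp add: power_mult_distrib power_divide)
  also have "\<dots> \<le> (real n * real l ^ (k - 1)) * (1/2) ^ i / real l ^ k"
    by (intro divide_right_mono mult_mono[OF Q(3) pow]) auto
  also have "\<dots> = real n / real q"
  proof -
    have "real l ^ k = real l * real l ^ (k - 1)" using \<open>k > 1\<close> by (cases k) auto
    then show ?thesis unfolding q using l0 by (simp add: field_simps power_one_over)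
  qed
  finally have "real q * (p ^ k * real (card (cop k \<pi> X))) \<le> real n"
    using q0 by (simp add: le_divide_eq mult.commute)
  moreover have "real c * (real q * real t) \<le> real c * (2 * real n)" using qt by (intro mult_left_mono) auto
  \<comment> \<open>Origin of \<open>4 * c + 2\<close>: the linear term contributes
    \<open>2 * c * (q * t) \<le> 4 * c * n\<close>, the surviving copies
    \<open>2 * n\<close>.\<close>
  ultimately have B: "real q * (2 * (real c * real t + p ^ k * real (card (cop k \<pi> X)))) \<le> (4 * real c + 2) * real n"
    by (simp add: algebra_simps)
  have "real q * real (card (heavy p q X)) \<le> (4 * real c + 2) * real n"
    by (rule order_trans[OF mult_left_mono[OF hl(1)] B]) (use \<open>k > 1\<close> in auto)
  then have "real (q * card (heavy p q X)) \<le> real ((4 * c + 2) * n)"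
    by (simp only: of_nat_mult of_nat_add of_nat_numeral)
  then show "q * card (heavy p q X) \<le> (4 * c + 2) * n" by (simp only: of_nat_le_iff)
  have "real q * (p * real (card (light_points p q X))) \<le> (4 * real c + 2) * real n"
    by (rule order_trans[OF mult_left_mono[OF hl(2)] B]) (use \<open>k > 1\<close> in auto)
  moreover have "real q * p = Q * (5/4) ^ i"
    unfolding p q using l0 by (simp add: field_simps flip: power_mult_distrib)
  ultimately have "(4 * real c + 2) * (10 * (5/4) ^ i * real (card (light_points p q X))) \<le> (4 * real c + 2) * real n"
    by (simp only: Q(1) mult.assoc[symmetric] mult.commute[of 10])
  then have le: "10 * (5/4) ^ i * real (card (light_points p q X)) \<le> real n"
    by (rule mult_left_le_imp_le) (simp add: add_nonneg_pos)
  have "real (card (light_points p q X)) = (10 * (5/4) ^ i * real (card (light_points p q X))) * ((4/5) ^ i / 10)"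
    by (simp add: field_simps)
  also have "\<dots> \<le> real n * ((4/5) ^ i / 10)" by (rule mult_right_mono[OF le]) simp
  finally show "real (card (light_points p q X)) \<le> real n / 10 * (4/5) ^ i" by simp
qed

text \<open>\<open>L\<close> collects the points that are light at some scale up to
  \<open>n\<close>, so the others meet only heavy cells at these scales. The sizes are bounded by a
  geometric series of sum at most \<open>(n / 10) * 5\<close>; the factor \<open>10\<close> in
  \<open>Q\<close> is there to make this \<open>n / 2\<close>.\<close>

lemma light_heavy_decomposition:
  fixes c n m l k :: nat
  assumes c: "linear_avoidance_bound k \<pi> c"
    and \<pi>: "inj_on \<pi> {1..k}" and "k > 1" and X: "X \<subseteq> {..<n} \<times> {..<n}" "card (cop k \<pi> X) \<le> m"
    and Q: "Q = 10 * (4 * real c + 2)" "Q \<le> real l" "real m * Q ^ k \<le> real n * real l ^ (k - 1)"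
  obtains L where "L \<subseteq> X" "2 * card L \<le> n" "X - L \<in> scale_sparse (4 * c + 2) n l"
proof -
  define p where "p i = Q * (5/8) ^ i / real l" for i
  define q where "q i = 2 ^ i * l" for i :: nat
  define L where "L = (\<Union>i\<in>{i. q i \<le> n}. light_points (p i) (q i) X)"
  have "Q > 0" using Q(1) by simp
  then have "l > 0" using Q(2) by (cases l) auto
  have fin: "finite X" using X(1) finite_subset by blast
  note sc = scale_bounds[OF c \<pi> \<open>k > 1\<close> X Q q_def _ p_def]
  have I: "{i. q i \<le> n} \<subseteq> {..<n}"
  proof safe
    fix i assume "q i \<le> n"
    moreover have "2 ^ i * 1 \<le> q i" unfolding q_def using \<open>l > 0\<close> by (intro mult_left_mono) auto
    ultimately show "i < n" using less_exp[of i] by linarith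
  qed
  then have finI: "finite {i. q i \<le> n}" using finite_subset by blast
  have "card L \<le> (\<Sum>i\<in>{i. q i \<le> n}. card (light_points (p i) (q i) X))"
    unfolding L_def by (rule card_UN_le[OF finI])
  then have "real (card L) \<le> (\<Sum>i\<in>{i. q i \<le> n}. real (card (light_points (p i) (q i) X)))"
    by (metis of_nat_le_iff of_nat_sum)
  also have "\<dots> \<le> (\<Sum>i\<in>{i. q i \<le> n}. real n / 10 * (4/5) ^ i)" by (intro sum_mono sc(2)) auto
  also have "\<dots> \<le> (\<Sum>i<n. real n / 10 * (4/5) ^ i)" using I by (intro sum_mono2) auto
  also have "\<dots> = real n / 10 * ((1 - (4/5) ^ n) / (1 - 4/5))"
    by (simp only: sum_distrib_left[symmetric]) (subst sum_gp_strict, simp)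
  also have "\<dots> \<le> real n / 10 * 5" by (intro mult_left_mono) auto
  finally have "2 * real (card L) \<le> real n" by simp
  then have L: "2 * card L \<le> n" by linarith
  have "min n (2 ^ i * l) * card (contr (2 ^ i * l) (X - L)) \<le> (4 * c + 2) * n" for i
  proof (cases "q i \<le> n")
    case True
    have "contr (q i) (X - L) \<subseteq> heavy (p i) (q i) X"
      unfolding contr_def L_def light_points_def using True by blast
    then have "card (contr (q i) (X - L)) \<le> card (heavy (p i) (q i) X)"
      by (intro card_mono) (simp_all add: heavy_def finite_contr fin)
    then have "min n (q i) * card (contr (q i) (X - L)) \<le> q i * card (heavy (p i) (q i) X)"
      by (intro mult_le_mono) auto
    also have "\<dots> \<le> (4 * c + 2) * n" using sc(1)[OF True] .
    finally show ?thesis unfolding q_def .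
  next
    case False
    have "contr (q i) (X - L) \<subseteq> {(0, 0)}" by (rule contr_large[of _ n]) (use X False in auto)
    then have "card (contr (q i) (X - L)) \<le> card {(0::nat, 0::nat)}" by (intro card_mono) auto
    then have "min n (q i) * card (contr (q i) (X - L)) \<le> n * 1" by (intro mult_le_mono) auto
    then show ?thesis unfolding q_def by simp
  qed
  then have "X - L \<in> scale_sparse (4 * c + 2) n l" unfolding scale_sparse_def using X by blast
  moreover have "L \<subseteq> X" unfolding L_def light_points_def by blast
  ultimately show ?thesis using that L by blast
qed

text \<open>A permutation is recovered from its light part, a bijection from some \<open>D\<close>
  to some \<open>R\<close>, and its sparse remainder over the other columns. At most
  \<open>4 ^ n\<close> pairs \<open>(D, R)\<close> occur. The rows of the remainder are not
  prescribed, which only overcounts. \<open>B\<close> dominates the contribution of one pair,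
  whatever the size \<open>n'\<close> of the light part.\<close>

lemma card_partial_perms_recursion:
  fixes c n m l k :: nat
  assumes c: "linear_avoidance_bound k \<pi> c"
    and \<pi>: "inj_on \<pi> {1..k}" and "k > 1"
    and Q: "Q = 10 * (4 * real c + 2)" "Q \<le> real l" "real m * Q ^ k \<le> real n * real l ^ (k - 1)"
    and B: "\<And>n'. 2 * n' \<le> n \<Longrightarrow> real (card (partial_perms k \<pi> {..<n'} {..<n'} m))
       * (2 * 16 powr (2 * real (4 * c + 2) * real n / real l) * (real l ^ (n - n') * 2 ^ ((4 * c + 2) * n))) \<le> B"
  shows "real (card (partial_perms k \<pi> {..<n} {..<n} m)) \<le> 4 ^ n * B"
proof -
  let ?c = "4 * c + 2"
  let ?P = "\<lambda>(D, R). partial_perms k \<pi> D R m"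
  let ?N = "\<lambda>(D, R::nat set). {N \<in> scale_sparse ?c n l. inj_on fst N \<and> fst ` N = {..<n} - D}"
  define J where "J = {(D, R). D \<subseteq> {..<n} \<and> R \<subseteq> {..<n} \<and> card R = card D \<and> 2 * card D \<le> n}"
  have "Q > 0" using Q(1) by simp
  then have "l > 0" using Q(2) by (cases l) auto
  have J: "J \<subseteq> Pow {..<n} \<times> Pow {..<n}" unfolding J_def by auto
  then have finJ: "finite J" using finite_subset by blast
  have cardJ: "card J \<le> 4 ^ n"
  proof -
    have "card J \<le> card (Pow {..<n} \<times> Pow {..<n})" by (rule card_mono[OF _ J]) simp
    also have "\<dots> = 4 ^ n" by (simp add: card_cartesian_product card_Pow flip: power_mult_distrib)
    finally show ?thesis .
  qed
  have sub: "partial_perms k \<pi> {..<n} {..<n} m \<subseteq> (\<Union>j\<in>J. (\<lambda>(L, N). L \<union> N) ` (?P j \<times> ?N j))"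
  proof
    fix X assume "X \<in> partial_perms k \<pi> {..<n} {..<n} m"
    then have X: "X \<subseteq> {..<n} \<times> {..<n}" "inj_on fst X" "inj_on snd X" "card X = n" "card (cop k \<pi> X) \<le> m"
      unfolding partial_perms_def by auto
    obtain L where L: "L \<subseteq> X" "2 * card L \<le> n" "X - L \<in> scale_sparse ?c n l"
      using light_heavy_decomposition[OF c \<pi> \<open>k > 1\<close> X(1,5) Q] by blast
    have finX: "finite X" using X(1) finite_subset by blast
    have inj: "inj_on fst L" "inj_on snd L" using X L(1) inj_on_subset by blast+
    have cL: "card (fst ` L) = card L" "card (snd ` L) = card L" using inj by (simp_all add: card_image)
    have subL: "fst ` L \<subseteq> {..<n}" "snd ` L \<subseteq> {..<n}" using L(1) X(1) by auto
    have j: "(fst ` L, snd ` L) \<in> J" unfolding J_def using cL subL L(2) by simp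
    have "card (cop k \<pi> L) \<le> m"
      using card_mono[OF finite_cop[OF finX] cop_mono[OF L(1)]] X(5) by (rule order_trans)
    moreover have "L \<subseteq> fst ` L \<times> snd ` L" by (rule subset_fst_snd)
    ultimately have P: "L \<in> partial_perms k \<pi> (fst ` L) (snd ` L) m"
      unfolding partial_perms_def using inj cL by simp
    have "fst ` X = {..<n}"
      by (rule card_subset_eq) (use X card_image[OF X(2)] in auto)
    then have "fst ` (X - L) = {..<n} - fst ` L" using inj_on_image_set_diff[OF X(2), of X L] L(1) by simp
    then have N: "X - L \<in> ?N (fst ` L, snd ` L)" using L(3) inj_on_subset[OF X(2)] by auto
    have "X = (\<lambda>(L, N). L \<union> N) (L, X - L)" using L(1) by auto
    then show "X \<in> (\<Union>j\<in>J. (\<lambda>(L, N). L \<union> N) ` (?P j \<times> ?N j))"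
      using j P N by (intro UN_I[OF j] image_eqI[of _ _ "(L, X - L)"]) auto
  qed
  have finN: "finite (?N j)" for j using finite_scale_sparse by (auto split: prod.split)
  have finP: "finite (?P j)" if j: "j \<in> J" for j
  proof -
    obtain D R where "j = (D, R)" "D \<subseteq> {..<n}" "R \<subseteq> {..<n}" using j unfolding J_def by blast
    then show ?thesis by (simp add: finite_partial_perms finite_subset[of _ "{..<n}"])
  qed
  have finU: "finite (\<Union>j\<in>J. (\<lambda>(L, N). L \<union> N) ` (?P j \<times> ?N j))"
    using finJ finP finN by (intro finite_UN_I finite_imageI finite_cartesian_product)
  have "card (partial_perms k \<pi> {..<n} {..<n} m) \<le> card (\<Union>j\<in>J. (\<lambda>(L, N). L \<union> N) ` (?P j \<times> ?N j))"
    by (rule card_mono[OF finU sub])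
  also have "\<dots> \<le> (\<Sum>j\<in>J. card ((\<lambda>(L, N). L \<union> N) ` (?P j \<times> ?N j)))" by (rule card_UN_le[OF finJ])
  also have "\<dots> \<le> (\<Sum>j\<in>J. card (?P j) * card (?N j))"
  proof (rule sum_mono)
    fix j assume "j \<in> J"
    have "card ((\<lambda>(L, N). L \<union> N) ` (?P j \<times> ?N j)) \<le> card (?P j \<times> ?N j)"
      using finP[OF \<open>j \<in> J\<close>] finN by (intro card_image_le finite_cartesian_product)
    then show "card ((\<lambda>(L, N). L \<union> N) ` (?P j \<times> ?N j)) \<le> card (?P j) * card (?N j)"
      by (simp only: card_cartesian_product)
  qed
  finally have "real (card (partial_perms k \<pi> {..<n} {..<n} m)) \<le> real (\<Sum>j\<in>J. card (?P j) * card (?N j))"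
    by (simp only: of_nat_le_iff)
  also have "\<dots> = (\<Sum>j\<in>J. real (card (?P j)) * real (card (?N j)))" by simp
  also have "\<dots> \<le> of_nat (card J) * B"
  proof (rule sum_bounded_above)
    fix j assume "j \<in> J"
    then obtain D R where j: "j = (D, R)" and DR: "D \<subseteq> {..<n}" "R \<subseteq> {..<n}" "card R = card D" "2 * card D \<le> n"
      unfolding J_def by blast
    have fin: "finite D" "finite R" using DR finite_subset by blast+
    have "card ({..<n} - D) = n - card D" using card_Diff_subset[OF fin(1) DR(1)] by simp
    then have "real (card (?N j)) \<le> 2 * 16 powr (2 * real ?c * real n / real l) * (real l ^ (n - card D) * 2 ^ (?c * n))"
      using card_scale_sparse_graphs[OF \<open>l > 0\<close>, of "{..<n} - D" n ?c] j by simp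
    moreover have "real (card (?P j)) \<le> real (card (partial_perms k \<pi> {..<card D} {..<card D} m))"
      using card_partial_perms_standardize[OF \<pi> fin refl DR(3)] j by simp
    ultimately have "real (card (?P j)) * real (card (?N j)) \<le> real (card (partial_perms k \<pi> {..<card D} {..<card D} m))
      * (2 * 16 powr (2 * real ?c * real n / real l) * (real l ^ (n - card D) * 2 ^ (?c * n)))"
      by (intro mult_mono) auto
    also have "\<dots> \<le> B" by (rule B[OF DR(4)])
    finally show "real (card (?P j)) * real (card (?N j)) \<le> B" .
  qed
  also have "\<dots> \<le> 4 ^ n * B"
  proof (rule mult_right_mono)
    show "real (card J) \<le> 4 ^ n" using cardJ by (metis of_nat_le_iff of_nat_numeral of_nat_power)
    \<comment> \<open>The size \<open>n' = 0\<close> is always admissible, so \<open>B\<close>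
      dominates a nonnegative number.\<close>
    have "0 \<le> real (card (partial_perms k \<pi> {..<0} {..<0} m))
       * (2 * 16 powr (2 * real ?c * real n / real l) * (real l ^ (n - 0) * 2 ^ (?c * n)))" by simp
    also have "\<dots> \<le> B" by (rule B) simp
    finally show "0 \<le> B" .
  qed
  finally show ?thesis .
qed

section \<open>Choice of the finest scale and solution of the recursion\<close>

lemma mult_ln_diff_le:
  assumes "n' \<le> (n::nat)" shows "real n' * (ln (real n) - ln (real n')) \<le> real n"
proof (cases "n' = 0")
  case False
  then have pos: "real n' > 0" "real n > 0" using assms by auto
  then have "ln (real n) - ln (real n') = ln (real n / real n')" by (simp add: ln_div)
  also have "\<dots> \<le> real n / real n'" using pos by (intro ln_bound) auto
  finally have "real n' * (ln (real n) - ln (real n')) \<le> real n' * (real n / real n')"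
    using pos by (intro mult_left_mono) auto
  then show ?thesis using pos by simp
qed simp

text \<open>\<open>a\<close> is the logarithm of \<open>s = (m/n)^(1/(k-1))\<close>, and
  \<open>l\<close> is \<open>Q^2 * s\<close> rounded up, at the cost of a factor \<open>2\<close>.
  The square serves all \<open>k \<ge> 2\<close> at once, since
  \<open>Q ^ k \<le> Q ^ (2 * (k - 1))\<close>.\<close>

lemma upper_bound_scale:
  fixes Q :: real and n m k :: nat
  assumes "Q \<ge> 1" "k > 1" "0 < n" "n \<le> m"
  defines "a \<equiv> (ln (real m) - ln (real n)) / real (k - 1)"
  obtains l :: nat where "l > 0" "Q \<le> real l" "real m * Q ^ k \<le> real n * real l ^ (k - 1)"
    "ln (real l) \<le> ln (2 * Q\<^sup>2) + a"
proof -
  define l where "l = nat \<lceil>Q\<^sup>2 * exp a\<rceil>"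
  have "a \<ge> 0" unfolding a_def using assms by simp
  then have s1: "exp a \<ge> 1" by simp
  have Q2: "Q\<^sup>2 \<ge> Q" "Q\<^sup>2 \<ge> 1" using \<open>Q \<ge> 1\<close>
    using self_le_power[of Q 2] one_le_power[of Q 2] by simp_all
  have "Q\<^sup>2 * exp a \<ge> Q\<^sup>2 * 1" using s1 Q2 by (intro mult_left_mono) auto
  then have x: "Q\<^sup>2 * exp a \<ge> Q" "Q\<^sup>2 * exp a \<ge> 1" using Q2 by linarith+
  have l1: "Q\<^sup>2 * exp a \<le> real l" unfolding l_def by (rule real_nat_ceiling_ge)
  have l2: "real l \<le> 2 * Q\<^sup>2 * exp a" unfolding l_def using x(2) by linarith
  show ?thesis
  proof (rule that)
    show "Q \<le> real l" using l1 x by linarith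
    show l0: "l > 0" using l1 x by (cases l) auto
    have "ln (real l) \<le> ln (2 * Q\<^sup>2 * exp a)" by (rule ln_mono) (use l2 l0 in auto)
    also have "\<dots> = ln (2 * Q\<^sup>2) + a" using Q2 by (subst ln_mult) auto
    finally show "ln (real l) \<le> ln (2 * Q\<^sup>2) + a" .
    have "real (k - 1) * a = ln (real m) - ln (real n)" unfolding a_def using \<open>k > 1\<close> by simp
    then have "exp a ^ (k - 1) = exp (ln (real m) - ln (real n))" by (simp add: exp_of_nat_mult[symmetric])
    also have "\<dots> = real m / real n" using assms by (simp add: exp_diff)
    finally have s: "exp a ^ (k - 1) = real m / real n" .
    have "Q ^ k \<le> Q ^ (2 * (k - 1))" using assms by (intro power_increasing) auto
    then have "real m * Q ^ k \<le> real m * Q ^ (2 * (k - 1))" by (intro mult_left_mono) auto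
    also have "\<dots> = real n * (Q\<^sup>2 * exp a) ^ (k - 1)"
      using \<open>0 < n\<close> unfolding power_mult_distrib s by (simp add: power_mult)
    also have "\<dots> \<le> real n * real l ^ (k - 1)"
      using l1 Q2 by (intro mult_left_mono power_mono) auto
    finally show "real m * Q ^ k \<le> real n * real l ^ (k - 1)" .
  qed
qed

lemma card_partial_perms_bound:
  assumes c: "linear_avoidance_bound k \<pi> c" and \<pi>: "inj_on \<pi> {1..k}" and "k > 1"
  obtains C :: real where "\<And>n m. n \<le> m \<Longrightarrow> real (card (partial_perms k \<pi> {..<n} {..<n} m))
    \<le> exp (C * real n + real n * ((ln (real m) - ln (real n)) / real (k - 1)))"
proof -
  define d where "d = real (4 * c + 2)"
  define Q where "Q = 10 * (4 * real c + 2)"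
  \<comment> \<open>One term per exponential cost: the factor \<open>2\<close> and the power of
    \<open>16\<close> from counting contractions, the constant factor in \<open>l\<close>, the
    heights inside given cells, the \<open>4 ^ n\<close> pairs \<open>(D, R)\<close>, and the change
    from \<open>m / n'\<close> to \<open>m / n\<close>.\<close>
  define K where "K = ln 2 + 2 * d * ln 16 + ln (2 * Q\<^sup>2) + d * ln 2 + ln 4 + 1"
  have d: "d \<ge> 0" unfolding d_def by simp
  have Q: "Q \<ge> 1" unfolding Q_def by simp
  have "Q\<^sup>2 \<ge> 1" using Q by simp
  then have lnQ: "ln (2 * Q\<^sup>2) \<ge> 0" by (intro ln_ge_zero) linarith
  have K: "K \<ge> 0" unfolding K_def using d lnQ by (intro add_nonneg_nonneg mult_nonneg_nonneg) auto
  have "real (card (partial_perms k \<pi> {..<n} {..<n} m))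
    \<le> exp (2 * K * real n + real n * ((ln (real m) - ln (real n)) / real (k - 1)))" if "n \<le> m" for n m
    using that
  proof (induction n rule: less_induct)
    case (less n)
    let ?F = "\<lambda>n. real (card (partial_perms k \<pi> {..<n} {..<n} m))"
    show ?case
    proof (cases "n = 0")
      case True
      have "partial_perms k \<pi> {} {} m \<subseteq> {{}}" unfolding partial_perms_def by auto
      then have "card (partial_perms k \<pi> {} {} m) \<le> card {{} :: (nat \<times> nat) set}" by (intro card_mono) auto
      then show ?thesis using True by simp
    next
      case False
      define a where "a = (ln (real m) - ln (real n)) / real (k - 1)"
      have n: "n > 0" using False by simp
      obtain l where l: "l > 0" "Q \<le> real l" "real m * Q ^ k \<le> real n * real l ^ (k - 1)"
        "ln (real l) \<le> ln (2 * Q\<^sup>2) + a"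
        using upper_bound_scale[OF Q \<open>k > 1\<close> n less.prems] unfolding a_def by blast
      have k1: "real (k - 1) \<ge> 1" using \<open>k > 1\<close> by simp
      have "?F n \<le> 4 ^ n * exp (2 * K * real n + real n * a - real n * ln 4)"
      proof (rule card_partial_perms_recursion[OF c \<pi> \<open>k > 1\<close> Q_def l(2,3)])
        fix n' assume n': "2 * n' \<le> n"
        have IH: "?F n' \<le> exp (2 * K * real n' + real n' * ((ln (real m) - ln (real n')) / real (k - 1)))"
          by (rule less.IH) (use n' n less.prems in auto)
        have e1: "2 \<le> exp (real n * ln 2)"
          using n exp_le_cancel_iff[of "ln 2" "real n * ln 2"] by simp
        have "2 * d * real n / real l \<le> 2 * d * real n / 1"
          using l(1) d by (intro divide_left_mono) auto
        then have "(16::real) powr (2 * d * real n / real l) \<le> 16 powr (2 * d * real n)"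
          by (intro powr_mono) auto
        then have e2: "(16::real) powr (2 * d * real n / real l) \<le> exp (2 * d * real n * ln 16)"
          by (simp add: powr_def)
        have "real l ^ (n - n') = exp (real (n - n') * ln (real l))"
          using l(1) by (simp add: exp_of_nat_mult)
        also have "\<dots> \<le> exp (real (n - n') * (ln (2 * Q\<^sup>2) + a))"
          using l(4) by (auto intro: mult_left_mono)
        finally have e3: "real l ^ (n - n') \<le> exp (real (n - n') * (ln (2 * Q\<^sup>2) + a))" .
        have e4: "(2::real) ^ ((4 * c + 2) * n) = exp (d * real n * ln 2)"
          unfolding d_def by (metis exp_ln exp_of_nat_mult of_nat_mult zero_less_numeral)
        have "real n' * ((ln (real m) - ln (real n')) / real (k - 1))
            = real n' * a + real n' * (ln (real n) - ln (real n')) / real (k - 1)"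
          unfolding a_def times_divide_eq_right add_divide_distrib[symmetric] distrib_left[symmetric] by simp
        \<comment> \<open>Replacing \<open>m / n'\<close> by \<open>m / n\<close> costs
          \<open>n' * ln (n / n') \<le> n\<close>, from \<open>ln x \<le> x\<close>, and division by
          \<open>k - 1 \<ge> 1\<close> keeps it below \<open>n\<close>.\<close>
        also have "real n' * (ln (real n) - ln (real n')) / real (k - 1) \<le> real n / 1"
          using mult_ln_diff_le[of n' n] n' k1 by (intro frac_le) auto
        finally have b: "real n' * ((ln (real m) - ln (real n')) / real (k - 1)) \<le> real n' * a + real n" by simp
        \<comment> \<open>The light part has at most half of the points, so the inductive bound uses
          only \<open>K n\<close> of the available \<open>2 K n\<close>; the other
          \<open>K n\<close> pays for the present step.\<close>
        have b2: "2 * K * real n' \<le> K * real n"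
          using mult_left_mono[of "real (2 * n')" "real n" K] K n' by simp
        have b3: "real (n - n') * (ln (2 * Q\<^sup>2) + a) \<le> real n * ln (2 * Q\<^sup>2) + (real n - real n') * a"
          using n' lnQ by (simp add: of_nat_diff algebra_simps)
        have "?F n' * (2 * 16 powr (2 * d * real n / real l) * (real l ^ (n - n') * 2 ^ ((4 * c + 2) * n)))
          \<le> exp (2 * K * real n' + real n' * ((ln (real m) - ln (real n')) / real (k - 1)))
            * (exp (real n * ln 2) * exp (2 * d * real n * ln 16)
               * (exp (real (n - n') * (ln (2 * Q\<^sup>2) + a)) * exp (d * real n * ln 2)))"
          unfolding e4 by (intro mult_mono IH e1 e2 e3) auto
        also have "\<dots> = exp (2 * K * real n' + real n' * ((ln (real m) - ln (real n')) / real (k - 1))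
            + (real n * ln 2 + 2 * d * real n * ln 16 + (real (n - n') * (ln (2 * Q\<^sup>2) + a) + d * real n * ln 2)))"
          by (simp only: exp_add)
        also have "\<dots> \<le> exp (2 * K * real n + real n * a - real n * ln 4)"
        proof -
          have "K * real n = real n * ln 2 + 2 * d * real n * ln 16 + real n * ln (2 * Q\<^sup>2)
              + d * real n * ln 2 + real n * ln 4 + real n"
            unfolding K_def by (simp add: algebra_simps)
          \<comment> \<open>The main terms of the light part and the remainder recombine exactly, so
            the factor \<open>(m / n) ^ (n / (k - 1))\<close> suffers no loss.\<close>
          moreover have "(real n - real n') * a + real n' * a = real n * a" by (simp add: algebra_simps)
          moreover have "x + y + (e1 + e2 + (z + e4)) \<le> 2 * K * real n + w - e5"
            if "x \<le> K * real n" "y \<le> p + real n" "z \<le> q + r" "r + p = w"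
              "K * real n = e1 + e2 + q + e4 + e5 + real n" for x y z w p q r e1 e2 e4 e5 :: real
            using that by linarith
          ultimately show ?thesis unfolding exp_le_cancel_iff using b b2 b3 by blast
        qed
        finally show "?F n' * (2 * 16 powr (2 * real (4 * c + 2) * real n / real l)
            * (real l ^ (n - n') * 2 ^ ((4 * c + 2) * n))) \<le> exp (2 * K * real n + real n * a - real n * ln 4)"
          unfolding d_def .
      qed
      also have "(4::real) ^ n = exp (real n * ln 4)" by (simp add: exp_of_nat_mult)
      also have "exp (real n * ln 4) * exp (2 * K * real n + real n * a - real n * ln 4)
          = exp (2 * K * real n + real n * a)" by (simp flip: exp_add)
      finally show ?thesis unfolding a_def .
    qed
  qed
  then show ?thesis by (rule that)
qed

section \<open>Passage from permutations to their graphs\<close>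

lemma finite_copies: "finite (copies k \<pi> n \<sigma>)"
  unfolding copies_def by (rule finite_subset[of _ "{1..k} \<rightarrow>\<^sub>E {1..n}"]) (auto intro: finite_PiE)

text \<open>A copy in the graph is determined by its first coordinates, and these form an index map
  counted by \<open>copies\<close>.\<close>

lemma card_cop_graph:
  "card (cop k \<pi> ((\<lambda>x. (x, \<sigma> x)) ` {1..n})) \<le> num_copies k \<pi> n \<sigma>"
  unfolding num_copies_def
proof (rule card_inj_on_le)
  let ?G = "(\<lambda>x. (x, \<sigma> x)) ` {1..n}"
  let ?r = "\<lambda>g. restrict (fst \<circ> g) {1..k}"
  have G: "g i = (fst (g i), \<sigma> (fst (g i)))" "fst (g i) \<in> {1..n}"
    if "g \<in> cop k \<pi> ?G" "i \<in> {1..k}" for g i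
    using copD(1)[OF that] by auto
  show "?r ` cop k \<pi> ?G \<subseteq> copies k \<pi> n \<sigma>"
  proof (rule image_subsetI)
    fix g assume g: "g \<in> cop k \<pi> ?G"
    have s: "snd (g i) = \<sigma> (fst (g i))" if "i \<in> {1..k}" for i using G(1)[OF g that] by (metis snd_conv)
    have "strict_mono_on {1..k} (?r g)"
      by (rule strict_mono_onI) (use copD(2)[OF g] in simp)
    moreover have "?r g \<in> {1..k} \<rightarrow>\<^sub>E {1..n}" using G(2)[OF g] by simp
    moreover have "\<pi> i < \<pi> j \<longleftrightarrow> \<sigma> (?r g i) < \<sigma> (?r g j)" if "i \<in> {1..k}" "j \<in> {1..k}" for i j
      using copD(3)[OF g that] s that by simp
    ultimately show "?r g \<in> copies k \<pi> n \<sigma>" unfolding copies_def by blast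
  qed
  show "inj_on ?r (cop k \<pi> ?G)"
  proof (rule inj_onI)
    fix g h assume g: "g \<in> cop k \<pi> ?G" and h: "h \<in> cop k \<pi> ?G" and eq: "?r g = ?r h"
    show "g = h"
    proof (rule PiE_ext[OF copD(4)[OF g] copD(4)[OF h]])
      fix i assume i: "i \<in> {1..k}"
      then have "fst (g i) = fst (h i)" using fun_cong[OF eq, of i] by simp
      then show "g i = h i" using G(1)[OF g i] G(1)[OF h i] by metis
    qed
  qed
qed (rule finite_copies)

lemma num_perms_le_partial_perms:
  assumes "inj_on \<pi> {1..k}" "m \<le> m'"
  shows "num_perms_at_most k \<pi> n m \<le> card (partial_perms k \<pi> {..<n} {..<n} m')"
proof -
  let ?G = "\<lambda>\<sigma>. (\<lambda>x. (x, \<sigma> x)) ` {1..n}"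
  have "num_perms_at_most k \<pi> n m \<le> card (partial_perms k \<pi> {1..n} {1..n} m')"
    unfolding num_perms_at_most_def
  proof (rule card_inj_on_le)
    show "?G ` {\<sigma>. \<sigma> permutes {1..n} \<and> num_copies k \<pi> n \<sigma> \<le> m} \<subseteq> partial_perms k \<pi> {1..n} {1..n} m'"
    proof safe
      fix \<sigma> assume \<sigma>: "\<sigma> permutes {1..n}" "num_copies k \<pi> n \<sigma> \<le> m"
      have "card (cop k \<pi> (?G \<sigma>)) \<le> m'" using card_cop_graph[of k \<pi> \<sigma> n] \<sigma>(2) assms(2) by linarith
      moreover have "inj_on snd (?G \<sigma>)" using permutes_inj[OF \<sigma>(1)] by (auto simp: inj_on_def)
      moreover have "?G \<sigma> \<subseteq> {1..n} \<times> {1..n}" using permutes_in_image[OF \<sigma>(1)] by blast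
      moreover have "card (?G \<sigma>) = card {1..n}" by (intro card_image) (auto simp: inj_on_def)
      moreover have "inj_on fst (?G \<sigma>)" by (auto simp: inj_on_def)
      ultimately show "?G \<sigma> \<in> partial_perms k \<pi> {1..n} {1..n} m'" unfolding partial_perms_def by blast
    qed
    show "inj_on ?G {\<sigma>. \<sigma> permutes {1..n} \<and> num_copies k \<pi> n \<sigma> \<le> m}"
    proof (rule inj_onI, rule ext)
      fix \<sigma> \<tau> x
      assume \<sigma>: "\<sigma> \<in> {\<sigma>. \<sigma> permutes {1..n} \<and> num_copies k \<pi> n \<sigma> \<le> m}"
        and \<tau>: "\<tau> \<in> {\<sigma>. \<sigma> permutes {1..n} \<and> num_copies k \<pi> n \<sigma> \<le> m}" and eq: "?G \<sigma> = ?G \<tau>"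
      show "\<sigma> x = \<tau> x"
      proof (cases "x \<in> {1..n}")
        case True
        then have "(x, \<sigma> x) \<in> ?G \<tau>" unfolding eq[symmetric] by blast
        then show ?thesis by blast
      next
        case False
        have "\<sigma> permutes {1..n}" "\<tau> permutes {1..n}" using \<sigma> \<tau> by auto
        then show ?thesis using False permutes_not_in[of \<sigma> _ x] permutes_not_in[of \<tau> _ x] by metis
      qed
    qed
  qed (simp add: finite_partial_perms)
  also have "\<dots> \<le> card (partial_perms k \<pi> {..<n} {..<n} m')"
    by (rule card_partial_perms_standardize) (use assms in auto)
  finally show ?thesis .
qed

lemma num_perms_upper_bound:
  fixes k :: nat
  assumes "k > 1" "\<pi> permutes {1..k}"
  shows "\<exists>C::real. \<forall>m n :: nat. real (num_perms_at_most k \<pi> n m)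
      \<le> exp (C * real n) * max 1 ((real m / real n) powr (real n / real (k - 1)))"
proof -
  have inj: "inj_on \<pi> {1..k}" using permutes_inj_on[OF assms(2)] .
  obtain c where "linear_avoidance_bound k \<pi> c" using marcus_tardos assms by blast
  from card_partial_perms_bound[OF this inj assms(1)]
  obtain C where C: "\<And>n m. n \<le> m \<Longrightarrow> real (card (partial_perms k \<pi> {..<n} {..<n} m))
    \<le> exp (C * real n + real n * ((ln (real m) - ln (real n)) / real (k - 1)))" by blast
  have "real (num_perms_at_most k \<pi> n m)
      \<le> exp (C * real n) * max 1 ((real m / real n) powr (real n / real (k - 1)))" for m n
  proof -
    \<comment> \<open>Raising the threshold to \<open>max m n\<close> reaches the range
      \<open>n \<le> m\<close>. If \<open>m \<le> n\<close>, the logarithms then cancel, and this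
      gives the \<open>1\<close> in the maximum.\<close>
    have "real (num_perms_at_most k \<pi> n m) \<le> real (card (partial_perms k \<pi> {..<n} {..<n} (max m n)))"
      using num_perms_le_partial_perms[OF inj, of m "max m n" n] by simp
    also have "\<dots> \<le> exp (C * real n + real n * ((ln (real (max m n)) - ln (real n)) / real (k - 1)))"
      by (rule C) simp
    also have "\<dots> = exp (C * real n) * exp (real n * ((ln (real (max m n)) - ln (real n)) / real (k - 1)))"
      by (simp only: exp_add)
    also have "\<dots> \<le> exp (C * real n) * max 1 ((real m / real n) powr (real n / real (k - 1)))"
    proof (rule mult_left_mono)
      show "exp (real n * ((ln (real (max m n)) - ln (real n)) / real (k - 1)))
          \<le> max 1 ((real m / real n) powr (real n / real (k - 1)))"
      proof (cases "n = 0 \<or> m \<le> n")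
        case True
        then show ?thesis by auto
      next
        case False
        then have "(real m / real n) powr (real n / real (k - 1))
            = exp (real n / real (k - 1) * (ln (real m) - ln (real n)))"
          by (simp add: powr_def ln_div)
        then show ?thesis using False by simp
      qed
    qed simp
    finally show ?thesis .
  qed
  then show ?thesis by blast
qed

section \<open>The lower bound\<close>

lemma finite_perms_at_most: "finite {\<sigma>. \<sigma> permutes {1..n} \<and> num_copies k \<pi> n \<sigma> \<le> m}"
  by (rule finite_subset[OF _ finite_permutations[of "{1..n}"]]) auto

lemma num_perms_mono: "m \<le> m' \<Longrightarrow> num_perms_at_most k \<pi> n m \<le> num_perms_at_most k \<pi> n m'"
  unfolding num_perms_at_most_def by (rule card_mono[OF finite_perms_at_most]) auto

text \<open>The identity is increasing, so it has no copy of a pattern whose last value lies below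
  its first.\<close>

lemma num_perms_pos:
  assumes "k > 1" "\<pi> k < \<pi> 1" shows "num_perms_at_most k \<pi> n m \<ge> 1"
proof -
  have "copies k \<pi> n id = {}"
  proof (rule equals0I)
    fix x assume x: "x \<in> copies k \<pi> n id"
    have k: "1 \<in> {1..k}" "k \<in> {1..k}" using assms by auto
    have "x 1 < x k"
      by (rule strict_mono_onD[of "{1..k}"]) (use x k assms in \<open>auto simp: copies_def\<close>)
    moreover have "x k < x 1" using x k assms unfolding copies_def by auto
    ultimately show False by simp
  qed
  then have "id \<in> {\<sigma>. \<sigma> permutes {1..n} \<and> num_copies k \<pi> n \<sigma> \<le> m}"
    by (simp add: num_copies_def permutes_id)
  then show ?thesis unfolding num_perms_at_most_def
    using finite_perms_at_most[of n k \<pi> m] by (metis One_nat_def Suc_leI card_gt_0_iff empty_iff)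
qed

text \<open>A copy of a pattern with \<open>\<pi> k < \<pi> 1\<close> in a direct sum cannot start in the first summand and end
  in the second one.\<close>

lemma copies_direct_sum:
  assumes "k > 1" "\<pi> k < \<pi> 1" and \<sigma>: "\<sigma> permutes {1..n}" and \<tau>: "\<tau> permutes {n+1..n+s}"
  shows "copies k \<pi> (n + s) (\<sigma> \<circ> \<tau>) \<subseteq> copies k \<pi> n \<sigma> \<union> ({1..k} \<rightarrow>\<^sub>E {n+1..n+s})"
proof
  fix x assume x: "x \<in> copies k \<pi> (n + s) (\<sigma> \<circ> \<tau>)"
  have k: "1 \<in> {1..k}" "k \<in> {1..k}" using assms by auto
  have range: "x i \<in> {1..n+s}" if "i \<in> {1..k}" for i using x that unfolding copies_def by auto
  have sm: "strict_mono_on {1..k} x" using x unfolding copies_def by blast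
  have mono: "x i \<le> x j" if "i \<in> {1..k}" "j \<in> {1..k}" "i \<le> j" for i j
    using strict_mono_onD[OF sm that(1,2)] that(3) by (cases "i = j") auto
  have low: "(\<sigma> \<circ> \<tau>) y = \<sigma> y" "\<sigma> y \<le> n" if "y \<in> {1..n}" for y
    using that permutes_not_in[OF \<tau>, of y] permutes_in_image[OF \<sigma>, of y] by auto
  have high: "(\<sigma> \<circ> \<tau>) y > n" if "y \<in> {n+1..n+s}" for y
    using that permutes_in_image[OF \<tau>, of y] permutes_not_in[OF \<sigma>, of "\<tau> y"] by auto
  have less: "(\<sigma> \<circ> \<tau>) (x k) < (\<sigma> \<circ> \<tau>) (x 1)" using x k assms(2) unfolding copies_def by blast
  show "x \<in> copies k \<pi> n \<sigma> \<union> ({1..k} \<rightarrow>\<^sub>E {n+1..n+s})"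
  proof (cases "x k \<le> n")
    case True
    then have r: "x i \<in> {1..n}" if "i \<in> {1..k}" for i
      using range[OF that] mono[OF that k(2)] that by auto
    have "x \<in> {1..k} \<rightarrow>\<^sub>E {1..n}" using x r unfolding copies_def by auto
    moreover have "\<pi> i < \<pi> j \<longleftrightarrow> \<sigma> (x i) < \<sigma> (x j)" if ij: "i \<in> {1..k}" "j \<in> {1..k}" for i j
    proof -
      have "\<pi> i < \<pi> j \<longleftrightarrow> (\<sigma> \<circ> \<tau>) (x i) < (\<sigma> \<circ> \<tau>) (x j)" using x ij unfolding copies_def by blast
      then show ?thesis using low(1)[OF r[OF ij(1)]] low(1)[OF r[OF ij(2)]] by simp
    qed
    ultimately show ?thesis using sm unfolding copies_def by blast
  next
    case False
    then have xk: "x k \<in> {n+1..n+s}" using range[OF k(2)] by auto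
    have "x 1 > n"
    proof (rule ccontr)
      assume "\<not> x 1 > n"
      then have "x 1 \<in> {1..n}" using range[OF k(1)] by auto
      then show False using low[of "x 1"] high[OF xk] less by simp
    qed
    then have "x i \<in> {n+1..n+s}" if "i \<in> {1..k}" for i
      using range[OF that] mono[OF k(1) that] that by auto
    then have "x \<in> {1..k} \<rightarrow>\<^sub>E {n+1..n+s}" using x unfolding copies_def by auto
    then show ?thesis by blast
  qed
qed

text \<open>Any of the \<open>s!\<close> permutations of a new block may be appended. The added
  copies lie inside the block, hence among the \<open>s ^ k\<close> maps from \<open>{1..k}\<close>
  into it.\<close>

lemma num_perms_direct_sum:
  assumes "k > 1" "\<pi> k < \<pi> 1"
  shows "fact s * num_perms_at_most k \<pi> n a \<le> num_perms_at_most k \<pi> (n + s) (a + s ^ k)"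
proof -
  let ?A = "{\<sigma>. \<sigma> permutes {1..n} \<and> num_copies k \<pi> n \<sigma> \<le> a}" and ?B = "{\<tau>. \<tau> permutes {n+1..n+s}}"
  have "card (?A \<times> ?B) \<le> num_perms_at_most k \<pi> (n + s) (a + s ^ k)"
    unfolding num_perms_at_most_def
  proof (rule card_inj_on_le)
    show "(\<lambda>(\<sigma>, \<tau>). \<sigma> \<circ> \<tau>) ` (?A \<times> ?B)
      \<subseteq> {\<sigma>. \<sigma> permutes {1..n+s} \<and> num_copies k \<pi> (n + s) \<sigma> \<le> a + s ^ k}"
    proof safe
      fix \<sigma> \<tau> assume \<sigma>: "\<sigma> permutes {1..n}" "num_copies k \<pi> n \<sigma> \<le> a" and \<tau>: "\<tau> permutes {n+1..n+s}"
      have "\<sigma> permutes {1..n+s}" "\<tau> permutes {1..n+s}"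
        by (rule permutes_subset[OF \<sigma>(1)], simp, rule permutes_subset[OF \<tau>], simp)
      then show "\<sigma> \<circ> \<tau> permutes {1..n+s}" by (intro permutes_compose)
      have "num_copies k \<pi> (n + s) (\<sigma> \<circ> \<tau>) \<le> card (copies k \<pi> n \<sigma> \<union> ({1..k} \<rightarrow>\<^sub>E {n+1..n+s}))"
        unfolding num_copies_def
        by (rule card_mono[OF _ copies_direct_sum[OF assms \<sigma>(1) \<tau>]]) (simp add: finite_copies finite_PiE)
      also have "\<dots> \<le> card (copies k \<pi> n \<sigma>) + card ({1..k} \<rightarrow>\<^sub>E {n+1..n+s})" by (rule card_Un_le)
      also have "\<dots> \<le> a + s ^ k" using \<sigma>(2) by (simp add: num_copies_def card_PiE)
      finally show "num_copies k \<pi> (n + s) (\<sigma> \<circ> \<tau>) \<le> a + s ^ k" .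
    qed
    show "inj_on (\<lambda>(\<sigma>, \<tau>). \<sigma> \<circ> \<tau>) (?A \<times> ?B)"
    \<comment> \<open>The product determines \<open>\<sigma>\<close> on the first block, where
      \<open>\<tau>\<close> is the identity, and then \<open>\<tau>\<close> by cancellation.\<close>
    proof (rule inj_onI; clarsimp)
      fix \<sigma> \<tau> \<sigma>' \<tau>'
      assume p: "\<sigma> permutes {Suc 0..n}" "\<tau> permutes {Suc n..n+s}" "\<sigma>' permutes {Suc 0..n}" "\<tau>' permutes {Suc n..n+s}"
        and eq: "\<sigma> \<circ> \<tau> = \<sigma>' \<circ> \<tau>'"
      have "\<sigma> x = \<sigma>' x" for x
      proof (cases "x \<in> {Suc 0..n}")
        case True
        then have "\<tau> x = x" "\<tau>' x = x" using permutes_not_in[OF p(2), of x] permutes_not_in[OF p(4), of x] by auto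
        then show ?thesis using fun_cong[OF eq, of x] by simp
      qed (simp add: permutes_not_in[OF p(1)] permutes_not_in[OF p(3)])
      then have "\<sigma> = \<sigma>'" by blast
      moreover have "\<tau> x = \<tau>' x" for x
        using fun_cong[OF eq, of x] \<open>\<sigma> = \<sigma>'\<close> permutes_inj[OF p(1)] by (simp add: inj_eq)
      ultimately show "\<sigma> = \<sigma>' \<and> \<tau> = \<tau>'" by blast
    qed
  qed (rule finite_perms_at_most)
  moreover have "card ?B = fact s" by (subst card_permutations[of _ s]) auto
  ultimately show ?thesis by (simp add: card_cartesian_product num_perms_at_most_def mult.commute)
qed

text \<open>\<open>n ^ n / n!\<close> is one term of the series for \<open>exp n\<close>.\<close>

lemma power_le_exp_fact: "real n ^ n \<le> exp (real n) * fact n"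
proof -
  have "(\<Sum>i\<in>{n}. real n ^ i /\<^sub>R fact i) \<le> (\<Sum>i. real n ^ i /\<^sub>R fact i)"
    by (rule sum_le_suminf[OF summable_exp_generic]) auto
  then have "real n ^ n / fact n \<le> exp (real n)" unfolding exp_def by (simp add: divide_inverse mult.commute)
  then show ?thesis by (simp add: divide_le_eq)
qed

text \<open>Blocks of length \<open>s\<close> are split off one at a time. Each adds at most
  \<open>s ^ k = s * s ^ (k - 1)\<close> copies, a budget of \<open>s ^ (k - 1)\<close> per point.
  The extra \<open>exp s\<close> pays for the last block, which may be shorter.\<close>

lemma num_perms_lower_bound_blocks:
  fixes k s n :: nat
  assumes "k > 1" "\<pi> k < \<pi> 1" "s > 0"
  shows "real s ^ n \<le> exp (real n + real s) * real (num_perms_at_most k \<pi> n (n * s ^ (k - 1)))"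
proof (induction n rule: less_induct)
  case (less n)
  let ?f = "num_perms_at_most k \<pi>"
  show ?case
  proof (cases "n < s")
    case True
    have "fact n * ?f 0 0 \<le> ?f n (n ^ k)" using num_perms_direct_sum[OF assms(1,2), of n 0 0] by simp
    also have "\<dots> \<le> ?f n (n * s ^ (k - 1))"
    proof (rule num_perms_mono)
      have "n ^ k = n * n ^ (k - 1)" using assms(1) by (cases k) auto
      also have "\<dots> \<le> n * s ^ (k - 1)" using True by (intro mult_left_mono power_mono) auto
      finally show "n ^ k \<le> n * s ^ (k - 1)" .
    qed
    finally have "fact n \<le> ?f n (n * s ^ (k - 1))"
      using num_perms_pos[OF assms(1,2), of 0 0] by (metis mult.right_neutral mult_le_mono2 order_trans)
    then have f: "fact n \<le> real (?f n (n * s ^ (k - 1)))" by (metis of_nat_fact of_nat_le_iff)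
    have "real s ^ n \<le> exp (real s) * real n ^ n"
    proof (cases "n = 0")
      case False
      \<comment> \<open>For the short block, \<open>x \<le> exp x\<close> at
        \<open>x = s / n\<close>, raised to the power \<open>n\<close>, trades \<open>s ^ n\<close>
        for \<open>n ^ n\<close> at the cost \<open>exp s\<close>.\<close>
      have "real s / real n \<le> exp (real s / real n)"
        using exp_ge_add_one_self[of "real s / real n"] by linarith
      then have "(real s / real n) ^ n \<le> exp (real s / real n) ^ n" by (intro power_mono) auto
      also have "\<dots> = exp (real s)" using False by (simp flip: exp_of_nat_mult)
      finally show ?thesis using False by (simp add: power_divide divide_le_eq)
    qed simp
    also have "\<dots> \<le> exp (real s) * (exp (real n) * fact n)" by (intro mult_left_mono power_le_exp_fact) auto
    also have "\<dots> = exp (real n + real s) * fact n" by (simp add: exp_add)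
    also have "\<dots> \<le> exp (real n + real s) * real (?f n (n * s ^ (k - 1)))" by (rule mult_left_mono[OF f]) simp
    finally show ?thesis .
  next
    case False
    have "s ^ k = s * s ^ (k - 1)" using assms(1) by (cases k) auto
    then have "(n - s) * s ^ (k - 1) + s ^ k = n * s ^ (k - 1)" using False by (simp flip: distrib_right)
    then have "fact s * ?f (n - s) ((n - s) * s ^ (k - 1)) \<le> ?f n (n * s ^ (k - 1))"
      using num_perms_direct_sum[OF assms(1,2), of s "n - s" "(n - s) * s ^ (k - 1)"] False by simp
    then have f: "fact s * real (?f (n - s) ((n - s) * s ^ (k - 1))) \<le> real (?f n (n * s ^ (k - 1)))"
      by (metis of_nat_fact of_nat_le_iff of_nat_mult)
    have IH: "real s ^ (n - s) \<le> exp (real (n - s) + real s) * real (?f (n - s) ((n - s) * s ^ (k - 1)))"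
      by (rule less.IH) (use False assms(3) in auto)
    have "real s ^ n = real s ^ s * real s ^ (n - s)" using False by (simp flip: power_add)
    also have "\<dots> \<le> (exp (real s) * fact s) * (exp (real (n - s) + real s) * real (?f (n - s) ((n - s) * s ^ (k - 1))))"
      by (intro mult_mono power_le_exp_fact IH) auto
    also have "\<dots> = exp (real n + real s) * (fact s * real (?f (n - s) ((n - s) * s ^ (k - 1))))"
      using False by (simp add: of_nat_diff exp_add[symmetric] ac_simps flip: mult.assoc)
    also have "\<dots> \<le> exp (real n + real s) * real (?f n (n * s ^ (k - 1)))" by (rule mult_left_mono[OF f]) simp
    finally show ?thesis .
  qed
qed

text \<open>The \<open>3\<close> in the exponent consists of one \<open>n\<close> for rounding
  \<open>r\<close> down to \<open>s\<close>, one for the factorials, and one for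
  \<open>exp s \<le> exp n\<close>.\<close>

lemma num_perms_lower_bound_descent:
  fixes k m n :: nat
  assumes "k > 1" "\<pi> k < \<pi> 1" "m \<le> n choose k"
  shows "exp (- 3 * real n) * max 1 ((real m / real n) powr (real n / real (k - 1)))
    \<le> real (num_perms_at_most k \<pi> n m)"
proof (cases "n = 0 \<or> m \<le> n")
  case True
  \<comment> \<open>For \<open>n = 0\<close> the quotient is \<open>0\<close> by the convention on
    division, and \<open>0 powr 0\<close> is \<open>0\<close>.\<close>
  have "(real m / real n) powr (real n / real (k - 1)) \<le> 1"
  proof (cases "n = 0")
    case False
    then have "real m / real n \<le> 1" using True by simp
    then show ?thesis by (intro powr_le1) auto
  qed simp
  then have "exp (- 3 * real n) * max 1 ((real m / real n) powr (real n / real (k - 1))) \<le> 1 * 1"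
    by (intro mult_mono) auto
  then show ?thesis using num_perms_pos[OF assms(1,2), of n m] by simp
next
  case False
  define r where "r = (real m / real n) powr (1 / real (k - 1))"
  define s where "s = nat \<lfloor>r\<rfloor>"
  have n: "n > 0" "n < m" using False by auto
  have "real m / real n \<ge> 1" using n by simp
  then have r1: "r \<ge> 1" unfolding r_def by (intro ge_one_powr_ge_zero) auto
  have rk: "r ^ (k - 1) = real m / real n"
    unfolding r_def using n assms(1) by (simp add: powr_powr flip: powr_realpow)
  have fl: "real s = of_int \<lfloor>r\<rfloor>" unfolding s_def using r1 by simp
  then have s1: "real s \<ge> 1" using r1 by simp
  have s: "s > 0" "real s \<le> r" "r \<le> 2 * real s" using s1 fl by linarith+
  have nk: "n * s ^ (k - 1) \<le> m"
  proof -
    have "real n * real s ^ (k - 1) \<le> real n * r ^ (k - 1)" using s by (intro mult_left_mono power_mono) auto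
    also have "\<dots> = real m" unfolding rk using n by simp
    finally have "real (n * s ^ (k - 1)) \<le> real m" by simp
    then show ?thesis by (simp only: of_nat_le_iff)
  qed
  \<comment> \<open>Here \<open>m \<le> n choose k\<close> enters: it gives
    \<open>m \<le> n ^ k\<close>, so a block length above \<open>n\<close> would exceed the budget
    of copies.\<close>
  have "s \<le> n"
  proof (rule ccontr)
    assume "\<not> s \<le> n"
    then have "n ^ (k - 1) < s ^ (k - 1)" using assms(1) by (intro power_strict_mono) auto
    then have "n * n ^ (k - 1) < n * s ^ (k - 1)" using n by simp
    moreover have "n ^ k = n * n ^ (k - 1)" using assms(1) by (cases k) auto
    moreover have "n choose k \<le> n ^ k"
      by (cases "k \<le> n") (simp_all add: binomial_le_pow binomial_eq_0)
    ultimately show False using nk assms(3) by linarith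
  qed
  have "(real m / real n) powr (real n / real (k - 1)) = r ^ n"
    unfolding r_def using n by (simp add: powr_powr flip: powr_realpow)
  moreover have "r ^ n \<ge> 1" using r1 by simp
  ultimately have "max 1 ((real m / real n) powr (real n / real (k - 1))) = r ^ n" by simp
  also have "r ^ n \<le> (2 * real s) ^ n" using s r1 by (intro power_mono) auto
  also have "\<dots> = 2 ^ n * real s ^ n" by (rule power_mult_distrib)
  also have "\<dots> \<le> exp (real n) * (exp (real n + real s) * real (num_perms_at_most k \<pi> n (n * s ^ (k - 1))))"
  proof (intro mult_mono num_perms_lower_bound_blocks assms s)
    have "(2::real) \<le> exp 1" using exp_ge_add_one_self[of 1] by simp
    then have "(2::real) ^ n \<le> exp 1 ^ n" by (intro power_mono) auto
    then show "(2::real) ^ n \<le> exp (real n)" by (simp flip: exp_of_nat_mult)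
  qed auto
  also have "\<dots> = exp (2 * real n + real s) * real (num_perms_at_most k \<pi> n (n * s ^ (k - 1)))"
    by (simp add: exp_add[symmetric] flip: mult.assoc)
  also have "\<dots> \<le> exp (3 * real n) * real (num_perms_at_most k \<pi> n m)"
    using \<open>s \<le> n\<close> num_perms_mono[OF nk, of k \<pi> n] by (intro mult_mono) auto
  finally have "exp (- 3 * real n) * max 1 ((real m / real n) powr (real n / real (k - 1)))
      \<le> exp (- 3 * real n) * (exp (3 * real n) * real (num_perms_at_most k \<pi> n m))"
    by (intro mult_left_mono) auto
  then show ?thesis by (simp add: exp_add[symmetric] flip: mult.assoc)
qed

section \<open>Complementation, for patterns whose first value lies below the last\<close>

definition complement_value :: "nat \<Rightarrow> nat \<Rightarrow> nat" where
  "complement_value n y = (if y \<in> {1..n} then n + 1 - y else y)"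

lemma complement_value_permutes: "complement_value n permutes {1..n}"
  by (rule inj_imp_permutes) (auto simp: complement_value_def inj_on_def split: if_splits)

text \<open>Reversing the values of both pattern and permutation keeps the same index sets as
  copies, and composing with \<open>complement_value n\<close> is injective.\<close>

lemma num_perms_complement:
  assumes "\<pi> permutes {1..k}"
  shows "num_perms_at_most k (complement_value k \<circ> \<pi>) n m \<le> num_perms_at_most k \<pi> n m"
  unfolding num_perms_at_most_def
proof (rule card_inj_on_le)
  let ?c = "complement_value"
  have less: "?c n a < ?c n b \<longleftrightarrow> b < a" if "a \<in> {1..n}" "b \<in> {1..n}" for n a b
    using that by (auto simp: complement_value_def)
  show "(\<lambda>\<sigma>. ?c n \<circ> \<sigma>) ` {\<sigma>. \<sigma> permutes {1..n} \<and> num_copies k (?c k \<circ> \<pi>) n \<sigma> \<le> m}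
      \<subseteq> {\<sigma>. \<sigma> permutes {1..n} \<and> num_copies k \<pi> n \<sigma> \<le> m}"
  proof safe
    fix \<sigma> assume \<sigma>: "\<sigma> permutes {1..n}" "num_copies k (?c k \<circ> \<pi>) n \<sigma> \<le> m"
    show "?c n \<circ> \<sigma> permutes {1..n}" by (rule permutes_compose[OF \<sigma>(1) complement_value_permutes])
    have "copies k \<pi> n (?c n \<circ> \<sigma>) \<subseteq> copies k (?c k \<circ> \<pi>) n \<sigma>"
    proof
      fix x assume x: "x \<in> copies k \<pi> n (?c n \<circ> \<sigma>)"
      then have r: "x \<in> {1..k} \<rightarrow>\<^sub>E {1..n}" unfolding copies_def by blast
      have "(?c k \<circ> \<pi>) i < (?c k \<circ> \<pi>) j \<longleftrightarrow> \<sigma> (x i) < \<sigma> (x j)" if ij: "i \<in> {1..k}" "j \<in> {1..k}" for i j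
      proof -
        have "\<pi> j < \<pi> i \<longleftrightarrow> (?c n \<circ> \<sigma>) (x j) < (?c n \<circ> \<sigma>) (x i)" using x ij unfolding copies_def by blast
        moreover have "\<pi> i \<in> {1..k}" "\<pi> j \<in> {1..k}" using permutes_in_image[OF assms] ij by blast+
        moreover have "\<sigma> (x i) \<in> {1..n}" "\<sigma> (x j) \<in> {1..n}"
          using permutes_in_image[OF \<sigma>(1)] PiE_mem[OF r] ij by blast+
        ultimately show ?thesis using less by simp
      qed
      then show "x \<in> copies k (?c k \<circ> \<pi>) n \<sigma>" using x unfolding copies_def by blast
    qed
    then show "num_copies k \<pi> n (?c n \<circ> \<sigma>) \<le> m"
      using \<sigma>(2) card_mono[OF finite_copies] unfolding num_copies_def by (meson le_trans)
  qed
  show "inj_on (\<lambda>\<sigma>. ?c n \<circ> \<sigma>) {\<sigma>. \<sigma> permutes {1..n} \<and> num_copies k (?c k \<circ> \<pi>) n \<sigma> \<le> m}"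
    using permutes_inj[OF complement_value_permutes[of n]] by (auto simp: inj_on_def fun.inj_map_strong fun_eq_iff)
qed (rule finite_perms_at_most)

lemma num_perms_lower_bound:
  fixes k :: nat
  assumes "k > 1" "\<pi> permutes {1..k}"
  shows "\<exists>C'::real. \<forall>m n :: nat. m \<le> n choose k \<longrightarrow>
    exp (C' * real n) * max 1 ((real m / real n) powr (real n / real (k - 1)))
      \<le> real (num_perms_at_most k \<pi> n m)"
proof (cases "\<pi> k < \<pi> 1")
  case True
  then show ?thesis using num_perms_lower_bound_descent[OF assms(1)] by blast
next
  case False
  have "\<pi> 1 \<noteq> \<pi> k" using permutes_inj[OF assms(2)] assms(1) by (auto dest: injD)
  moreover have "\<pi> 1 \<in> {1..k}" "\<pi> k \<in> {1..k}" using permutes_in_image[OF assms(2)] assms(1) by auto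
  ultimately have "(complement_value k \<circ> \<pi>) k < (complement_value k \<circ> \<pi>) 1"
    using False by (auto simp: complement_value_def)
  note lower = num_perms_lower_bound_descent[OF assms(1) this]
  have "exp (- 3 * real n) * max 1 ((real m / real n) powr (real n / real (k - 1)))
      \<le> real (num_perms_at_most k \<pi> n m)" if "m \<le> n choose k" for m n
    using lower[OF that] num_perms_complement[OF assms(2), of n m] by linarith
  then show ?thesis by blast
qed

theorem theorem2p3:
  fixes k :: nat and \<pi> :: "nat \<Rightarrow> nat"
  assumes "k > 1" and "\<pi> permutes {1..k}"
  shows "(\<exists>C::real. \<forall>m n :: nat. m \<le> n choose k \<longrightarrow>
            real (num_perms_at_most k \<pi> n m)
              \<le> exp (C * real n) * max 1 ((real m / real n) powr (real n / real (k - 1))))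
       \<and> (\<exists>C'::real. \<forall>m n :: nat. m \<le> n choose k \<longrightarrow>
            real (num_perms_at_most k \<pi> n m)
              \<ge> exp (C' * real n) * max 1 ((real m / real n) powr (real n / real (k - 1))))"
proof
  show "\<exists>C::real. \<forall>m n :: nat. m \<le> n choose k \<longrightarrow>
            real (num_perms_at_most k \<pi> n m)
              \<le> exp (C * real n) * max 1 ((real m / real n) powr (real n / real (k - 1)))"
    using num_perms_upper_bound[OF assms] by blast
  show "\<exists>C'::real. \<forall>m n :: nat. m \<le> n choose k \<longrightarrow>
            real (num_perms_at_most k \<pi> n m)
              \<ge> exp (C' * real n) * max 1 ((real m / real n) powr (real n / real (k - 1)))"
    by (rule num_perms_lower_bound[OF assms])
qed

end
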